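(* Consider the token-based central queue described in the context, and assume that its assignment rule satisfies the assignment condition and its departure rates satisfy the order-independent condition. Suppose moreover that $$\sum_{i=0}^K\ \sum_{(T_1,\dots,T_i)}\ \sum_{(n_1,\dots,n_i)\in\mathbb N_0^i}\frac{\Pi_\lambda(\{T_1,\dots,T_i\})}{\Pi_k(T_1,\dots,T_i)}\prod_{j=1}^i\alpha_j^{n_j}\prod_{m=1}^{i+\sum_j n_j}\frac1{\eta(m)}<\infty ,$$ where the middle sum runs over ordered tuples of distinct tokens. Then the Markov process on the state space $\mathcal X$ has the stationary distribution $$\pi(x)=\pi((0))\,\frac{\Pi_\lambda(\{T_1,\dots,T_i\})}{\Pi_k(T_1,\dots,T_i)}\,\prod_{j=1}^i\alpha_j^{n_j}\,\prod_{m=1}^{\phi(x)}\frac1{\eta(m)},\qquad x=(T_1,n_1,\dots,T_i,n_i)\in\mathcal X,$$ where $\pi((0))$ is the normalising constant (and the empty state corresponds to $i=0$).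
   Context: Token-based central queue. There is a finite set $\mathcal C$ of customer types; type-$c$ customers arrive according to independent Poisson processes with rates $\lambda_c>0$, and $\lambda=\sum_{c}\lambda_c$. There is a finite set of tokens $\mathcal T=\{t_1,\dots,t_K\}$; each type $c$ has a nonempty set $\mathcal T_c\subseteq\mathcal T$ of compatible tokens, and $\mathcal C_t=\{c: t\in\mathcal T_c\}$. A customer can receive service only while it holds a token ("active"); tokenless customers ("inactive") wait in a central queue and have departure rate $0$. An arriving type-$c$ customer that finds at least one available token in $\mathcal T_c$ immediately claims one of them according to a randomised assignment rule, whose probabilities may depend on the set of unavailable tokens and on the type; otherwise it waits. When a customer departs, its token is immediately claimed by the longest-waiting tokenless customer whose type lies in $\mathcal C_t$; if there is none, the token becomes available. State descriptor: $(0)$ denotes the empty system; otherwise the state is $x=(T_1,n_1,\dots,T_i,n_i)$, where $T_1,\dots,T_i$ are the distinct currently claimed tokens, listed in the order of arrival of their holders, and $n_j\ge0$ is the number of tokenless customers that arrived after the holder of $T_j$ and before the holder of $T_{j+1}$ ($n_i$ counts those arriving after the holder of $T_i$). $\mathcal X$ is the set of reachable states. For $\mathcal R\subseteq\mathcal T$ let $\mathcal U(\mathcal R)=\{c\in\mathcal C:\mathcal T_c\subseteq\mathcal R\}$ and $\lambda_{\mathcal U(\mathcal R)}=\sum_{c\in\mathcal U(\mathcal R)}\lambda_c$; the $n_j$ customers have types in $\mathcal U(\{T_1,\dots,T_j\})$. For $t\notin\mathcal R$, $\lambda_t(\mathcal R)$ denotes the total rate at which arriving customers claim token $t$ when $\mathcal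 R$ is the set of unavailable tokens. Assignment condition: for every $i\in\{1,\dots,K\}$ and distinct tokens $T_1,\dots,T_i$, the product $\prod_{j=1}^i\lambda_{T_j}(\{T_1,\dots,T_{j-1}\})$ is the same for every permutation of $(T_1,\dots,T_i)$; this common value is denoted $\Pi_\lambda(\{T_1,\dots,T_i\})$, with $\Pi_\lambda(\emptyset)=1$. Order-independent condition: in state $x=(T_1,n_1,\dots,T_i,n_i)$ the departure rate of the holder of $T_j$ is $\eta(\phi(x))\,s_j(T_1,\dots,T_j)$, where $\phi(x)=i+\sum_{j=1}^i n_j$ is the number of customers, each $s_j\ge0$ depends only on $(T_1,\dots,T_j)$, $k(T_1,\dots,T_i):=\sum_{j=1}^i s_j(T_1,\dots,T_j)$ is invariant under permutations of $(T_1,\dots,T_i)$, and $\eta(m)>0$ for $m\ge1$; $k(\emptyset)=0$. It is assumed that $k(T_1,\dots,T_j)>0$ for every nonempty tuple of distinct tokens. Notation: $\Pi_k(T_1,\dots,T_i)=\prod_{j=1}^i k(T_1,\dots,T_j)$ and $\alpha_j=\lambda_{\mathcal U(\{T_1,\dots,T_j\})}/k(T_1,\dots,T_j)$; the convention $0^0=1$ is used. *)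

theory Defs
  imports "HOL-Analysis.Analysis"
begin

text \<open>
  Customer types form a finite type 'c (the set C is UNIV), tokens form a finite
  type 't (the token set T is UNIV, K = CARD('t)).
  Parameters: lam c = arrival rate of type c; Tc c = compatible tokens of type c;
  p R c t = probability that an arriving type-c customer claims token t when R is
  the set of unavailable tokens (randomised assignment rule);
  s [T1,..,Tj] = s_j(T1,..,Tj); eta m = eta(m).
\<close>

definition lam_tok :: "('c::finite \<Rightarrow> real) \<Rightarrow> ('t set \<Rightarrow> 'c \<Rightarrow> 't \<Rightarrow> real) \<Rightarrow> 't set \<Rightarrow> 't \<Rightarrow> real" where
  "lam_tok lam p R t = (\<Sum>c\<in>UNIV. lam c * p R c t)"

text \<open>prod_{j=1}^i lambda_{T_j}({T_1..T_{j-1}}); by the assignment condition this is Pi_lambda({T_1..T_i}).\<close>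
definition Pi_lam :: "('c::finite \<Rightarrow> real) \<Rightarrow> ('t set \<Rightarrow> 'c \<Rightarrow> 't \<Rightarrow> real) \<Rightarrow> 't list \<Rightarrow> real" where
  "Pi_lam lam p ts = (\<Prod>j<length ts. lam_tok lam p (set (take j ts)) (ts ! j))"

definition kfun :: "('t list \<Rightarrow> real) \<Rightarrow> 't list \<Rightarrow> real" where
  "kfun s ts = (\<Sum>j<length ts. s (take (Suc j) ts))"

definition Pi_k :: "('t list \<Rightarrow> real) \<Rightarrow> 't list \<Rightarrow> real" where
  "Pi_k s ts = (\<Prod>j<length ts. kfun s (take (Suc j) ts))"

definition lamU :: "('c::finite \<Rightarrow> real) \<Rightarrow> ('c \<Rightarrow> 't set) \<Rightarrow> 't set \<Rightarrow> real" where
  "lamU lam Tc R = (\<Sum>c\<in>{c. Tc c \<subseteq> R}. lam c)"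

text \<open>alpha_j for the token tuple ts (j from 1 to length ts).\<close>
definition alpha :: "('c::finite \<Rightarrow> real) \<Rightarrow> ('c \<Rightarrow> 't set) \<Rightarrow> ('t list \<Rightarrow> real) \<Rightarrow> 't list \<Rightarrow> nat \<Rightarrow> real" where
  "alpha lam Tc s ts j = lamU lam Tc (set (take j ts)) / kfun s (take j ts)"

text \<open>Aggregated state (T_1,n_1,...,T_i,n_i) as the list [(T_1,n_1),...,(T_i,n_i)];
  the empty system (0) is the empty list. Unnormalised stationary weight
  (0^0 = 1 holds for Isabelle's power).\<close>
definition weight :: "('c::finite \<Rightarrow> real) \<Rightarrow> ('c \<Rightarrow> 't set) \<Rightarrow> ('t set \<Rightarrow> 'c \<Rightarrow> 't \<Rightarrow> real)
    \<Rightarrow> ('t list \<Rightarrow> real) \<Rightarrow> (nat \<Rightarrow> real) \<Rightarrow> ('t \<times> nat) list \<Rightarrow> real" where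
  "weight lam Tc p s eta x =
     (let ts = map fst x; ns = map snd x in
        Pi_lam lam p ts / Pi_k s ts
        * (\<Prod>j<length x. alpha lam Tc s ts (Suc j) ^ (ns ! j))
        * (\<Prod>m\<in>{1..length x + sum_list ns}. 1 / eta m))"

definition assignment_rule :: "('c \<Rightarrow> 't set) \<Rightarrow> ('t set \<Rightarrow> 'c \<Rightarrow> 't \<Rightarrow> real) \<Rightarrow> bool" where
  "assignment_rule Tc p \<longleftrightarrow>
     (\<forall>R c t. 0 \<le> p R c t \<and> (t \<notin> Tc c - R \<longrightarrow> p R c t = 0)) \<and>
     (\<forall>R c. Tc c - R \<noteq> {} \<longrightarrow> (\<Sum>t\<in>Tc c - R. p R c t) = 1)"

definition assignment_condition :: "('c::finite \<Rightarrow> real) \<Rightarrow> ('t set \<Rightarrow> 'c \<Rightarrow> 't \<Rightarrow> real) \<Rightarrow> bool" where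
  "assignment_condition lam p \<longleftrightarrow>
     (\<forall>xs ys. distinct xs \<and> mset ys = mset xs \<longrightarrow> Pi_lam lam p xs = Pi_lam lam p ys)"

definition order_independent :: "('t list \<Rightarrow> real) \<Rightarrow> (nat \<Rightarrow> real) \<Rightarrow> bool" where
  "order_independent s eta \<longleftrightarrow>
     (\<forall>ts. distinct ts \<longrightarrow> 0 \<le> s ts) \<and>
     (\<forall>xs ys. distinct xs \<and> mset ys = mset xs \<longrightarrow> kfun s xs = kfun s ys) \<and>
     (\<forall>m\<ge>1. 0 < eta m) \<and>
     (\<forall>ts. distinct ts \<and> ts \<noteq> [] \<longrightarrow> 0 < kfun s ts)"

text \<open>Detailed state: all customers in order of arrival, each with its type and
  its token (None = tokenless/inactive).\<close>

definition unavail :: "('c \<times> 't option) list \<Rightarrow> 't set" where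
  "unavail xs = {t. \<exists>c. (c, Some t) \<in> set xs}"

definition active_tokens :: "('c \<times> 't option) list \<Rightarrow> 't list" where
  "active_tokens xs = [the (snd y). y \<leftarrow> xs, snd y \<noteq> None]"

definition depart :: "('c \<Rightarrow> 't set) \<Rightarrow> ('c \<times> 't option) list \<Rightarrow> nat \<Rightarrow> ('c \<times> 't option) list" where
  "depart Tc xs k =
     (let t = the (snd (xs ! k)); ys = take k xs @ drop (Suc k) xs;
          ok = (\<lambda>w. w < length ys \<and> snd (ys ! w) = None \<and> t \<in> Tc (fst (ys ! w)))
      in if (\<exists>w. ok w) then (let w = (LEAST w. ok w) in ys[w := (fst (ys ! w), Some t)]) else ys)"

definition arr_rate :: "('c::finite \<Rightarrow> real) \<Rightarrow> ('c \<Rightarrow> 't set) \<Rightarrow> ('t set \<Rightarrow> 'c \<Rightarrow> 't \<Rightarrow> real)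
    \<Rightarrow> ('c \<times> 't option) list \<Rightarrow> ('c \<times> 't option) list \<Rightarrow> real" where
  "arr_rate lam Tc p xs ys =
     (\<Sum>c\<in>UNIV. if Tc c - unavail xs = {}
        then (if ys = xs @ [(c, None)] then lam c else 0)
        else (\<Sum>t\<in>Tc c - unavail xs. if ys = xs @ [(c, Some t)] then lam c * p (unavail xs) c t else 0))"

definition dep_rate :: "('c \<Rightarrow> 't set) \<Rightarrow> ('t list \<Rightarrow> real) \<Rightarrow> (nat \<Rightarrow> real)
    \<Rightarrow> ('c \<times> 't option) list \<Rightarrow> ('c \<times> 't option) list \<Rightarrow> real" where
  "dep_rate Tc s eta xs ys =
     (\<Sum>k<length xs. if snd (xs ! k) \<noteq> None \<and> depart Tc xs k = ys
        then eta (length xs) * s (active_tokens (take (Suc k) xs)) else 0)"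

definition Qrate :: "('c::finite \<Rightarrow> real) \<Rightarrow> ('c \<Rightarrow> 't set) \<Rightarrow> ('t set \<Rightarrow> 'c \<Rightarrow> 't \<Rightarrow> real)
    \<Rightarrow> ('t list \<Rightarrow> real) \<Rightarrow> (nat \<Rightarrow> real) \<Rightarrow> ('c \<times> 't option) list \<Rightarrow> ('c \<times> 't option) list \<Rightarrow> real" where
  "Qrate lam Tc p s eta xs ys = arr_rate lam Tc p xs ys + dep_rate Tc s eta xs ys"

text \<open>Total rate of leaving a state (every event changes the number of customers).\<close>
definition out_rate :: "('c::finite \<Rightarrow> real) \<Rightarrow> ('c \<Rightarrow> 't set) \<Rightarrow> ('t set \<Rightarrow> 'c \<Rightarrow> 't \<Rightarrow> real)
    \<Rightarrow> ('t list \<Rightarrow> real) \<Rightarrow> (nat \<Rightarrow> real) \<Rightarrow> ('c \<times> 't option) list \<Rightarrow> real" where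
  "out_rate lam Tc p s eta xs =
     (\<Sum>c\<in>UNIV. if Tc c - unavail xs = {} then lam c
        else (\<Sum>t\<in>Tc c - unavail xs. lam c * p (unavail xs) c t))
     + (\<Sum>k<length xs. if snd (xs ! k) \<noteq> None
          then eta (length xs) * s (active_tokens (take (Suc k) xs)) else 0)"

definition reach_det :: "('c::finite \<Rightarrow> real) \<Rightarrow> ('c \<Rightarrow> 't set) \<Rightarrow> ('t set \<Rightarrow> 'c \<Rightarrow> 't \<Rightarrow> real)
    \<Rightarrow> ('t list \<Rightarrow> real) \<Rightarrow> (nat \<Rightarrow> real) \<Rightarrow> ('c \<times> 't option) list set" where
  "reach_det lam Tc p s eta = {ys. (\<lambda>a b. 0 < Qrate lam Tc p s eta a b)\<^sup>*\<^sup>* [] ys}"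

definition agg_step :: "('t \<times> nat) list \<Rightarrow> ('c \<times> 't option) \<Rightarrow> ('t \<times> nat) list" where
  "agg_step acc y = (case snd y of
       Some t \<Rightarrow> acc @ [(t, 0)]
     | None \<Rightarrow> (if acc = [] then [] else butlast acc @ [(fst (last acc), Suc (snd (last acc)))]))"

definition aggr :: "('c \<times> 't option) list \<Rightarrow> ('t \<times> nat) list" where
  "aggr xs = foldl agg_step [] xs"

definition reach_agg :: "('c::finite \<Rightarrow> real) \<Rightarrow> ('c \<Rightarrow> 't set) \<Rightarrow> ('t set \<Rightarrow> 'c \<Rightarrow> 't \<Rightarrow> real)
    \<Rightarrow> ('t list \<Rightarrow> real) \<Rightarrow> (nat \<Rightarrow> real) \<Rightarrow> ('t \<times> nat) list set" where
  "reach_agg lam Tc p s eta = aggr ` reach_det lam Tc p s eta"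

definition stationary :: "('c::finite \<Rightarrow> real) \<Rightarrow> ('c \<Rightarrow> 't set) \<Rightarrow> ('t set \<Rightarrow> 'c \<Rightarrow> 't \<Rightarrow> real)
    \<Rightarrow> ('t list \<Rightarrow> real) \<Rightarrow> (nat \<Rightarrow> real) \<Rightarrow> (('c \<times> 't option) list \<Rightarrow> real) \<Rightarrow> bool" where
  "stationary lam Tc p s eta pr \<longleftrightarrow>
     (\<forall>x\<in>reach_det lam Tc p s eta. 0 \<le> pr x) \<and>
     (pr has_sum 1) (reach_det lam Tc p s eta) \<and>
     (\<forall>y\<in>reach_det lam Tc p s eta.
        pr y * out_rate lam Tc p s eta y
        = (\<Sum>\<^sub>\<infinity>x\<in>reach_det lam Tc p s eta. pr x * Qrate lam Tc p s eta x y))"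

end

theory Submission
  imports Defs
begin

text \<open>
  The detailed chain records the types of active customers, and for these no product form is
  available. Forgetting them (but keeping the types of waiting customers) gives a chain in
  which a customer contributes one factor to the weight, depending only on the set of tokens
  claimed before it. There two partial balances hold: the departure rate of a state balances the
  inflow by arrivals, and the total arrival rate balances the inflow by departures. The second one
  follows by induction on the state from the exchange symmetry of the assignment rates and
  of the service rates.

  The forgotten types are recovered without a formula. The jump operator of the detailed chain
  maps the set of nonnegative functions with the given (finite) fibre sums to itself; this set is
  convex and compact in the product topology, so the operator has a fixed point in it.
  Summing a fixed point over the states with the same aggregate gives the claimed weight.
\<close>

subsection \<open>Erased states and token reassignment\<close>

text \<open>Types of active customers never enter a rate, so erasing them is an exact lumping of the
  detailed chain. Erasing the waiting types too, as the aggregate state does, is in general not: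
  they decide who takes a released token. The intermediate state therefore lists the customers in
  order of arrival, \<open>Inl c\<close> for a waiting customer of type \<open>c\<close> and
  \<open>Inr t\<close> for the holder of \<open>t\<close>. A waiting customer contributes lambda_c /
  k; summed over the types that may wait at its place this becomes alpha_j, which is the origin of
  the powers of alpha_j in the formula.

  The weight is nonzero exactly on the erasures of reachable states, so sums over the aggregate of
  reachable states lose nothing. For the lift mere existence suffices, because all candidates share
  the same fibre sums.\<close>

definition tokens :: "('c + 't) list \<Rightarrow> 't list" where
  "tokens z = concat (map (case_sum (\<lambda>_. []) (\<lambda>t. [t])) z)"

lemma tokens_simps [simp]:
  "tokens [] = []" "tokens (Inl c # z) = tokens z" "tokens (Inr t # z) = t # tokens z"
  "tokens (z1 @ z2) = tokens z1 @ tokens z2"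
  by (simp_all add: tokens_def)

lemma set_tokens: "t \<in> set (tokens z) \<longleftrightarrow> Inr t \<in> set z"
  by (induction z) (auto simp: tokens_def split: sum.splits)

lemma tokens_split:
  assumes "t \<in> set (tokens z)"
  obtains z1 z2 where "z = z1 @ Inr t # z2" "t \<notin> set (tokens z1)"
  using assms by (metis set_tokens split_list_first)

fun claim :: "('c \<Rightarrow> 't set) \<Rightarrow> 't \<Rightarrow> ('c + 't) list \<Rightarrow> ('c + 't) list" where
  "claim Tc t [] = []"
| "claim Tc t (Inl c # z) = (if t \<in> Tc c then Inr t # z else Inl c # claim Tc t z)"
| "claim Tc t (Inr u # z) = Inr u # claim Tc t z"

lemma length_claim [simp]: "length (claim Tc t z) = length z"
  by (induction Tc t z rule: claim.induct) auto

definition no_taker :: "('c \<Rightarrow> 't set) \<Rightarrow> 't \<Rightarrow> ('c + 't) list \<Rightarrow> bool" where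
  "no_taker Tc t z \<longleftrightarrow> (\<forall>c. Inl c \<in> set z \<longrightarrow> t \<notin> Tc c)"

lemma no_taker_append [simp]:
  "no_taker Tc t (z1 @ z2) \<longleftrightarrow> no_taker Tc t z1 \<and> no_taker Tc t z2"
  by (auto simp: no_taker_def)

lemma claim_append:
  "claim Tc t (z1 @ z2) =
     (if no_taker Tc t z1 then z1 @ claim Tc t z2 else claim Tc t z1 @ z2)"
  by (induction Tc t z1 rule: claim.induct) (auto simp: no_taker_def)

lemma claim_no_taker: "no_taker Tc t z \<Longrightarrow> claim Tc t z = z"
  using claim_append[of Tc t z "[]"] by simp

lemma mset_tokens_claim:
  "\<not> no_taker Tc t z \<Longrightarrow> mset (tokens (claim Tc t z)) = add_mset t (mset (tokens z))"
  by (induction Tc t z rule: claim.induct) (auto simp: no_taker_def)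

lemma claim_taker_split:
  assumes "\<not> no_taker Tc t z"
  obtains z1 c z2 where "z = z1 @ Inl c # z2" "t \<in> Tc c" "claim Tc t z = z1 @ Inr t # z2"
proof -
  have "\<exists>z1 c z2. z = z1 @ Inl c # z2 \<and> t \<in> Tc c \<and> claim Tc t z = z1 @ Inr t # z2"
    using assms
  proof (induction Tc t z rule: claim.induct)
    case (2 Tc t c z)
    show ?case
    proof (cases "t \<in> Tc c")
      case True
      then show ?thesis by (intro exI[of _ "[]"]) auto
    next
      case False
      with 2 obtain z1 d z2 where "z = z1 @ Inl d # z2 \<and> t \<in> Tc d \<and> claim Tc t z = z1 @ Inr t # z2"
        by (auto simp: no_taker_def)
      with False show ?thesis by (intro exI[of _ "Inl c # z1"]) auto
    qed
  next
    case (3 Tc t u z)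
    then obtain z1 d z2 where "z = z1 @ Inl d # z2 \<and> t \<in> Tc d \<and> claim Tc t z = z1 @ Inr t # z2"
      by (auto simp: no_taker_def)
    then show ?case by (intro exI[of _ "Inr u # z1"]) auto
  qed (auto simp: no_taker_def)
  with that show ?thesis by blast
qed

lemma kfun_snoc: "kfun s (ts @ [t]) = kfun s ts + s (ts @ [t])"
  by (simp add: kfun_def)

lemma Pi_lam_snoc: "Pi_lam lam p (ts @ [t]) = Pi_lam lam p ts * lam_tok lam p (set ts) t"
  by (simp add: Pi_lam_def nth_append)

lemma Pi_k_snoc: "Pi_k s (ts @ [t]) = Pi_k s ts * kfun s (ts @ [t])"
  by (simp add: Pi_k_def)

section \<open>The model and the weight of erased states\<close>

locale token_queue =
  fixes lam :: "'c::finite \<Rightarrow> real" and Tc :: "'c \<Rightarrow> 't::finite set"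
    and p :: "'t set \<Rightarrow> 'c \<Rightarrow> 't \<Rightarrow> real" and s :: "'t list \<Rightarrow> real" and eta :: "nat \<Rightarrow> real"
  assumes lam_pos: "\<And>c. 0 < lam c"
    and Tc_nonempty: "\<And>c. Tc c \<noteq> {}"
    and rule: "assignment_rule Tc p"
    and acond: "assignment_condition lam p"
    and oi: "order_independent s eta"
begin

abbreviation "ltok \<equiv> lam_tok lam p"
abbreviation "k \<equiv> kfun s"
abbreviation "clm \<equiv> claim Tc"

lemma p_nonneg: "0 \<le> p R c t" and p_zero: "t \<notin> Tc c - R \<Longrightarrow> p R c t = 0"
  and p_sum: "Tc c - R \<noteq> {} \<Longrightarrow> (\<Sum>t\<in>Tc c - R. p R c t) = 1"
  using rule by (auto simp: assignment_rule_def)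

lemma ltok_nonneg: "0 \<le> ltok R t"
  unfolding lam_tok_def by (intro sum_nonneg mult_nonneg_nonneg p_nonneg less_imp_le[OF lam_pos])

lemma ltok_unavailable: "t \<in> R \<Longrightarrow> ltok R t = 0"
  by (simp add: lam_tok_def p_zero)

lemma Pi_lam_perm: "distinct xs \<Longrightarrow> mset ys = mset xs \<Longrightarrow> Pi_lam lam p xs = Pi_lam lam p ys"
  using acond unfolding assignment_condition_def by blast

lemma k_perm: "distinct xs \<Longrightarrow> mset ys = mset xs \<Longrightarrow> k xs = k ys"
  and k_pos: "distinct ts \<Longrightarrow> ts \<noteq> [] \<Longrightarrow> 0 < k ts"
  and s_nonneg: "distinct ts \<Longrightarrow> 0 \<le> s ts"
  and eta_pos: "1 \<le> m \<Longrightarrow> 0 < eta m"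
  using oi unfolding order_independent_def by blast+

text \<open>Swap the last two claims in the assignment condition; the hypothesis on
  \<open>Pi_lam\<close> lets the common prefix be cancelled.\<close>

lemma ltok_exchange:
  assumes "Pi_lam lam p ts \<noteq> 0" "distinct ts" "t \<notin> set ts" "u \<notin> set ts" "t \<noteq> u"
  shows "ltok (set ts) t * ltok (insert t (set ts)) u = ltok (set ts) u * ltok (insert u (set ts)) t"
proof -
  have "Pi_lam lam p ((ts @ [t]) @ [u]) = Pi_lam lam p ((ts @ [u]) @ [t])"
    by (rule Pi_lam_perm) (use assms in auto)
  then show ?thesis
    unfolding Pi_lam_snoc using assms(1) by (simp add: mult.assoc)
qed

text \<open>The value 0 for an uncovered type encodes that a customer waits only if all its tokens
  are held by customers ahead of it. A token already in \<open>ts\<close> gets 0 through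
  \<open>ltok_unavailable\<close>. In both cases the denominator is \<open>k\<close> of the tokens
  present once the entry is appended.\<close>

definition fac :: "'t list \<Rightarrow> 'c + 't \<Rightarrow> real" where
  "fac ts a = (case a of Inl c \<Rightarrow> if Tc c \<subseteq> set ts then lam c / k ts else 0
                       | Inr t \<Rightarrow> ltok (set ts) t / k (ts @ [t]))"

lemma fac_Inl: "fac ts (Inl c) = (if Tc c \<subseteq> set ts then lam c / k ts else 0)"
  and fac_Inr: "fac ts (Inr t) = ltok (set ts) t / k (ts @ [t])"
  by (simp_all add: fac_def)

text \<open>The factors \<open>1 / eta\<close> depend only on the number of customers; they are left out here and
  restored in \<open>wt\<close> below.\<close>

definition w0 :: "('c + 't) list \<Rightarrow> real" where
  "w0 z = (\<Prod>i<length z. fac (tokens (take i z)) (z ! i))"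

lemma w0_Nil [simp]: "w0 [] = 1" by (simp add: w0_def)

lemma w0_snoc: "w0 (z @ [a]) = w0 z * fac (tokens z) a"
  by (simp add: w0_def nth_append)

lemma w0_distinct: "w0 z \<noteq> 0 \<Longrightarrow> distinct (tokens z)"
proof (induction z rule: rev_induct)
  case (snoc a z)
  then show ?case
    by (cases a) (auto simp: w0_snoc fac_Inr ltok_unavailable)
qed simp

lemma fac_nonneg: "distinct ts \<Longrightarrow> 0 \<le> fac ts a"
proof (cases a)
  case (Inl c)
  assume "distinct ts"
  moreover have "ts \<noteq> []" if "Tc c \<subseteq> set ts"
    using that Tc_nonempty[of c] by auto
  ultimately show ?thesis
    using k_pos[of ts] lam_pos[of c] by (auto simp: Inl fac_Inl intro!: divide_nonneg_nonneg)
next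
  case (Inr t)
  assume "distinct ts"
  then show ?thesis
    using k_pos[of "ts @ [t]"] ltok_nonneg[of "set ts" t]
    by (cases "t \<in> set ts") (auto simp: Inr fac_Inr ltok_unavailable intro!: divide_nonneg_nonneg)
qed

lemma w0_nonneg: "0 \<le> w0 z"
proof (induction z rule: rev_induct)
  case (snoc a z)
  then show ?case
    using fac_nonneg[OF w0_distinct, of z a] by (cases "w0 z = 0") (auto simp: w0_snoc)
qed simp

lemma w0_append_zero: "w0 z1 = 0 \<Longrightarrow> w0 (z1 @ z2) = 0"
proof (induction z2 rule: rev_induct)
  case (snoc a z2)
  then show ?case by (simp only: append_assoc[symmetric] w0_snoc mult_zero_left)
qed simp

lemma w0_uncovered:
  assumes "t \<in> Tc c" "t \<notin> set (tokens z1)"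
  shows "w0 (z1 @ Inl c # z2) = 0"
proof -
  have "w0 (z1 @ [Inl c]) = 0" using assms by (auto simp: w0_snoc fac_Inl)
  then show ?thesis using w0_append_zero[of "z1 @ [Inl c]" z2] by simp
qed

text \<open>Numerators depend only on the token set, and \<open>k\<close> is permutation invariant
  on distinct tuples. A repeated token falls outside \<open>k_perm\<close> and is separate; there
  both rates are 0.\<close>

lemma fac_perm:
  assumes "mset ts = mset us" "distinct ts"
  shows "fac ts a = fac us a"
proof -
  have st: "set ts = set us" using assms(1) by (rule mset_eq_setD)
  show ?thesis
  proof (cases a)
    case (Inl c)
    then show ?thesis using k_perm[OF assms(2) assms(1)[symmetric]] st by (simp add: fac_Inl)
  next
    case (Inr t)
    show ?thesis
    proof (cases "t \<in> set ts")
      case True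
      then show ?thesis using st by (simp add: Inr fac_Inr ltok_unavailable)
    next
      case False
      then have "k (ts @ [t]) = k (us @ [t])"
        using assms by (intro k_perm) auto
      then show ?thesis using st by (simp add: Inr fac_Inr)
    qed
  qed
qed

lemma Pi_lam_w0: "w0 z \<noteq> 0 \<Longrightarrow> Pi_lam lam p (tokens z) \<noteq> 0"
proof (induction z rule: rev_induct)
  case Nil
  then show ?case by (simp add: Pi_lam_def)
next
  case (snoc a z)
  then show ?case
    by (cases a) (auto simp: w0_snoc fac_Inr Pi_lam_snoc)
qed

lemma waiting_covered:
  assumes "w0 z \<noteq> 0" "Inl c \<in> set z"
  shows "Tc c \<subseteq> set (tokens z)"
  using assms
proof (induction z rule: rev_induct)
  case (snoc a z)
  then show ?case
    by (cases a) (auto simp: w0_snoc fac_Inl split: if_splits)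
qed simp

lemma no_taker_w0: "w0 z \<noteq> 0 \<Longrightarrow> t \<notin> set (tokens z) \<Longrightarrow> no_taker Tc t z"
  using waiting_covered by (auto simp: no_taker_def)

section \<open>Inserting a token at every position\<close>

definition insert_at :: "nat \<Rightarrow> 't \<Rightarrow> ('c + 't) list \<Rightarrow> ('c + 't) list" where
  "insert_at i t z = take i z @ Inr t # drop i z"

lemma mset_tokens_insert_at: "mset (tokens (insert_at i t z)) = add_mset t (mset (tokens z))"
proof -
  have "mset (tokens z) = mset (tokens (take i z @ drop i z))" by simp
  then show ?thesis unfolding insert_at_def tokens_simps by simp
qed

text \<open>Read \<open>z\<close> as the queue left by a departing holder of \<open>t\<close> before
  \<open>t\<close> is offered again. The holder may have stood in any of the
  \<open>length z + 1\<close> gaps, and its service rate sees only its own token and those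
  ahead.\<close>

definition insertion_sum :: "'t \<Rightarrow> ('c + 't) list \<Rightarrow> real" where
  "insertion_sum t z = (\<Sum>i\<le>length z. w0 (insert_at i t z) * s (tokens (take i z) @ [t]))"

lemma insertion_sum_snoc:
  "insertion_sum t (z @ [a]) = (\<Sum>i\<le>length z. w0 (insert_at i t z @ [a]) * s (tokens (take i z) @ [t]))
       + w0 (z @ [a, Inr t]) * s (tokens (z @ [a]) @ [t])"
proof -
  have "insertion_sum t (z @ [a]) = (\<Sum>i\<le>length z. w0 (insert_at i t (z @ [a])) * s (tokens (take i (z @ [a])) @ [t]))
       + w0 (z @ [a, Inr t]) * s (tokens (z @ [a]) @ [t])"
    by (simp add: insertion_sum_def insert_at_def)
  also have "(\<Sum>i\<le>length z. w0 (insert_at i t (z @ [a])) * s (tokens (take i (z @ [a])) @ [t]))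
      = (\<Sum>i\<le>length z. w0 (insert_at i t z @ [a]) * s (tokens (take i z) @ [t]))"
    by (intro sum.cong) (auto simp: insert_at_def)
  finally show ?thesis .
qed

lemma w0_insert_at_snoc:
  assumes "mset ts = add_mset t (mset (tokens z))"
  shows "w0 (insert_at i t z @ [a]) = w0 (insert_at i t z) * fac ts a"
proof (cases "w0 (insert_at i t z) = 0")
  case False
  then have "distinct (tokens (insert_at i t z))" by (rule w0_distinct)
  then show ?thesis
    using fac_perm[of "tokens (insert_at i t z)" ts a] assms by (simp add: w0_snoc mset_tokens_insert_at)
qed (simp add: w0_snoc)

text \<open>Wherever \<open>t\<close> is inserted before \<open>a\<close>, the factor of
  \<open>a\<close> sees the same token set and can be pulled out; only the insertion behind
  \<open>a\<close> is left over. The inductions below run on this recursion.\<close>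

lemma insertion_sum_snoc_fac:
  assumes "mset ts = add_mset t (mset (tokens z))"
  shows "insertion_sum t (z @ [a]) = fac ts a * insertion_sum t z + w0 (z @ [a, Inr t]) * s (tokens (z @ [a]) @ [t])"
  unfolding insertion_sum_snoc w0_insert_at_snoc[OF assms]
  by (simp add: insertion_sum_def sum_distrib_left mult_ac del: tokens_simps)

text \<open>The order-independence identity: placing the token \<open>t\<close> at every possible position and
  weighting by its share of the service rate amounts to an arrival claiming \<open>t\<close>.\<close>

lemma insertion_sum_free:
  assumes "w0 z \<noteq> 0" "t \<notin> set (tokens z)"
  shows "insertion_sum t z = ltok (set (tokens z)) t * w0 z"
  using assms
proof (induction z rule: rev_induct)
  case Nil
  have "k [t] = s [t]" by (simp add: kfun_def)
  moreover have "0 < k [t]" by (rule k_pos) auto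
  ultimately show ?case
    using w0_snoc[of "[]" "Inr t"] by (simp add: insertion_sum_def insert_at_def fac_Inr)
next
  case (snoc a z)
  have z: "w0 z \<noteq> 0" and f: "fac (tokens z) a \<noteq> 0" and tz: "t \<notin> set (tokens z)"
    using snoc.prems by (auto simp: w0_snoc)
  have dz: "distinct (tokens z)" using z by (rule w0_distinct)
  have IH: "insertion_sum t z = ltok (set (tokens z)) t * w0 z" using snoc.IH z tz by blast
  have insertion_sum: "insertion_sum t (z @ [a]) = fac (tokens z @ [t]) a * insertion_sum t z + w0 (z @ [a, Inr t]) * s (tokens (z @ [a]) @ [t])"
    by (rule insertion_sum_snoc_fac) simp
  have w2: "w0 (z @ [a, Inr t]) = w0 (z @ [a]) * fac (tokens (z @ [a])) (Inr t)"
    using w0_snoc[of "z @ [a]" "Inr t"] by simp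
  show ?case
  proof (cases a)
    case (Inl c)
    have sub: "Tc c \<subseteq> set (tokens z)" and kz: "k (tokens z) \<noteq> 0"
      using f by (auto simp: Inl fac_Inl split: if_splits)
    have kt: "k (tokens z @ [t]) \<noteq> 0" using k_pos[of "tokens z @ [t]"] dz tz by simp
    \<comment> \<open>The last position contributes the increment of \<open>k\<close>. With T the
      tokens of \<open>z\<close> and up to common factors, the summands add up as 1 / k(T,t) +
      (k(T,t) - k(T)) / (k(T) k(T,t)) = 1 / k(T).\<close>
    have ks: "s (tokens z @ [t]) = k (tokens z @ [t]) - k (tokens z)" by (simp add: kfun_snoc)
    have wz: "w0 (z @ [a]) = w0 z * lam c / k (tokens z)"
      using sub by (simp add: w0_snoc Inl fac_Inl)
    show ?thesis
      unfolding insertion_sum w2 wz IH using sub kz kt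
      by (simp add: Inl fac_Inl fac_Inr ks subset_insertI2 field_simps)
  next
    case (Inr u)
    have ut: "u \<noteq> t" using snoc.prems by (auto simp: Inr)
    have uz: "u \<notin> set (tokens z)" using f by (auto simp: Inr fac_Inr ltok_unavailable)
    have ku: "k (tokens z @ [u]) \<noteq> 0" using k_pos[of "tokens z @ [u]"] dz uz by simp
    have kut: "k (tokens z @ [u, t]) \<noteq> 0" using k_pos[of "tokens z @ [u, t]"] dz uz tz ut by simp
    have ktu: "k (tokens z @ [t, u]) = k (tokens z @ [u, t])"
      by (rule k_perm) (use dz uz tz ut in auto)
    have ks: "s (tokens z @ [u, t]) = k (tokens z @ [u, t]) - k (tokens z @ [u])"
      using kfun_snoc[of s "tokens z @ [u]" t] by simp
    \<comment> \<open>The two summands claim \<open>t\<close> and \<open>u\<close> in opposite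
      orders. Exchanging the rates here, and the arguments of \<open>k\<close> by
      \<open>ktu\<close>, leaves the same telescoping as for a waiting \<open>a\<close>.\<close>
    have ex: "ltok (set (tokens z)) t * ltok (insert t (set (tokens z))) u
        = ltok (set (tokens z)) u * ltok (insert u (set (tokens z))) t"
      by (rule ltok_exchange) (use Pi_lam_w0[OF z] dz tz uz ut in auto)
    have wz: "w0 (z @ [a]) = w0 z * ltok (set (tokens z)) u / k (tokens z @ [u])"
      by (simp add: w0_snoc Inr fac_Inr)
    have "insertion_sum t (z @ [a]) = w0 z / k (tokens z @ [u, t]) *
          (ltok (set (tokens z)) t * ltok (insert t (set (tokens z))) u)
        + w0 (z @ [a]) * ltok (insert u (set (tokens z))) t / k (tokens z @ [u, t]) * s (tokens z @ [u, t])"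
      unfolding insertion_sum w2 IH by (simp add: Inr fac_Inr ktu)
    also have "\<dots> = ltok (set (tokens (z @ [a]))) t * w0 (z @ [a])"
      unfolding ex wz ks using ku kut by (simp add: Inr field_simps)
    finally show ?thesis .
  qed
qed

lemma insertion_sum_taken: "t \<in> set (tokens z) \<Longrightarrow> insertion_sum t z = 0"
  unfolding insertion_sum_def
proof (intro sum.neutral ballI)
  fix i assume "t \<in> set (tokens z)"
  then have "\<not> distinct (tokens (insert_at i t z))"
    using mset_tokens_insert_at[of i t z] mset_eq_imp_distinct_iff[of "tokens (insert_at i t z)" "t # tokens z"] by auto
  then show "w0 (insert_at i t z) * s (tokens (take i z) @ [t]) = 0"
    using w0_distinct by auto
qed

text \<open>Here \<open>t\<close> was just taken over by a waiting customer of type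
  \<open>c\<close>. Positions of \<open>t\<close> behind that customer have weight 0 by
  \<open>w0_uncovered\<close>, so \<open>insertion_sum_free\<close> on \<open>z1\<close> gives the
  rest, and the denominator of lambda_c / k is the one that \<open>Inr t\<close> contributes on the
  right. Entries of \<open>z2\<close> see the same token set on both sides.\<close>

lemma insertion_sum_waiting:
  assumes "w0 (z1 @ Inr t # z2) \<noteq> 0" "t \<in> Tc c"
  shows "insertion_sum t (z1 @ Inl c # z2) =
     (if Tc c \<subseteq> insert t (set (tokens z1)) then lam c else 0) * w0 (z1 @ Inr t # z2)"
  using assms(1)
proof (induction z2 rule: rev_induct)
  case Nil
  have z1: "w0 z1 \<noteq> 0" using Nil w0_append_zero by blast
  have t1: "t \<notin> set (tokens z1)" and d1: "distinct (tokens z1)" using w0_distinct[OF Nil] by auto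
  have kt: "k (tokens z1 @ [t]) \<noteq> 0" using k_pos[of "tokens z1 @ [t]"] d1 t1 by simp
  have "w0 (z1 @ [Inl c, Inr t]) = 0"
    using w0_uncovered assms(2) t1 by blast
  then have "insertion_sum t (z1 @ [Inl c]) = fac (tokens z1 @ [t]) (Inl c) * insertion_sum t z1"
    using insertion_sum_snoc_fac[of "tokens z1 @ [t]" t z1 "Inl c"] by simp
  then show ?case
    using kt by (simp add: insertion_sum_free[OF z1 t1] fac_Inl fac_Inr w0_snoc)
next
  case (snoc a z2)
  have w: "w0 (z1 @ Inr t # z2 @ [a]) = w0 (z1 @ Inr t # z2) * fac (tokens (z1 @ Inr t # z2)) a"
    using w0_snoc[of "z1 @ Inr t # z2" a] by simp
  have t1: "t \<notin> set (tokens z1)" using w0_distinct[OF snoc.prems] by auto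
  have "w0 (z1 @ Inl c # z2 @ [a, Inr t]) = 0"
    using w0_uncovered assms(2) t1 by blast
  then have "insertion_sum t ((z1 @ Inl c # z2) @ [a]) = fac (tokens (z1 @ Inr t # z2)) a * insertion_sum t (z1 @ Inl c # z2)"
    using insertion_sum_snoc_fac[of "tokens (z1 @ Inr t # z2)" t "z1 @ Inl c # z2" a] by simp
  then show ?case
    using snoc w by simp
qed

text \<open>This settles \<open>dep0_balance\<close> for targets of weight 0. Go through the
  customers behind the departing holder: once \<open>t\<close> is reassigned, the token set is the
  old one and the factors agree. Until then \<open>t\<close> is missing, and reordering the claims
  so that \<open>t\<close> comes last shows by the assignment condition that the claim rates
  concerned are still nonzero.\<close>

lemma w0_claim_nonzero:
  assumes "w0 (z1 @ Inr t # z2) \<noteq> 0"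
  shows "w0 (clm t (z1 @ z2)) \<noteq> 0"
  using assms
proof (induction z2 rule: rev_induct)
  case Nil
  have "w0 z1 \<noteq> 0" using Nil w0_append_zero by blast
  moreover have "t \<notin> set (tokens z1)" using w0_distinct[OF Nil] by auto
  ultimately show ?case by (simp add: claim_no_taker no_taker_w0)
next
  case (snoc a z2)
  let ?z = "z1 @ Inr t # z2" and ?y = "z1 @ z2"
  have w: "w0 (?z @ [a]) \<noteq> 0" using snoc.prems by simp
  then have z: "w0 ?z \<noteq> 0" and f: "fac (tokens ?z) a \<noteq> 0" unfolding w0_snoc by auto
  have IH: "w0 (clm t ?y) \<noteq> 0" using snoc.IH z by blast
  have d: "distinct (tokens ?z)" using w0_distinct[OF z] .
  have t: "t \<notin> set (tokens ?y)" using d by auto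
  have dy: "distinct (tokens ?y)" using d by auto
  have "w0 (clm t (?y @ [a])) \<noteq> 0"
  proof (cases "no_taker Tc t ?y")
    case False
    then have "mset (tokens (clm t ?y)) = mset (tokens ?z)" by (simp add: mset_tokens_claim)
    then have "fac (tokens (clm t ?y)) a = fac (tokens ?z) a"
      using fac_perm d by metis
    moreover have "clm t (?y @ [a]) = clm t ?y @ [a]"
      using False by (simp only: claim_append[of Tc t ?y] if_False)
    ultimately show ?thesis using IH f by (simp only: w0_snoc) simp
  next
    case True
    have y: "w0 ?y \<noteq> 0" using IH True by (simp add: claim_no_taker)
    have P: "Pi_lam lam p (tokens (?z @ [a])) \<noteq> 0" using w by (rule Pi_lam_w0)
    show ?thesis
    proof (cases a)
      case (Inl c)
      show ?thesis
      proof (cases "t \<in> Tc c")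
        case True
        have "Pi_lam lam p (tokens ?z) = Pi_lam lam p (tokens ?y @ [t])"
          by (rule Pi_lam_perm) (use d in auto)
        then have "ltok (set (tokens ?y)) t \<noteq> 0"
          using Pi_lam_w0[OF z] Pi_lam_snoc[of lam p "tokens ?y" t] by auto
        moreover have "k (tokens ?y @ [t]) \<noteq> 0"
          using k_pos[of "tokens ?y @ [t]"] dy t by simp
        ultimately have "w0 (?y @ [Inr t]) \<noteq> 0"
          using y unfolding w0_snoc fac_Inr by simp
        then show ?thesis
          using True \<open>no_taker Tc t ?y\<close> by (simp add: claim_append[of Tc t ?y] Inl del: append_assoc)
      next
        case False
        have "Tc c \<subseteq> set (tokens ?z)" using f by (auto simp: Inl fac_Inl split: if_splits)
        with False have sub: "Tc c \<subseteq> set (tokens ?y)" by auto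
        then have "tokens ?y \<noteq> []" using Tc_nonempty[of c] by (metis list.set(1) subset_empty)
        then have "k (tokens ?y) \<noteq> 0" using k_pos[of "tokens ?y"] dy by simp
        then have "w0 (?y @ [a]) \<noteq> 0"
          using y sub lam_pos[of c] unfolding w0_snoc Inl fac_Inl by simp
        then show ?thesis
          using False \<open>no_taker Tc t ?y\<close> by (simp add: claim_append[of Tc t ?y] Inl del: append_assoc)
      qed
    next
      case (Inr u)
      have du: "distinct (tokens (?z @ [a]))" using w by (rule w0_distinct)
      have "Pi_lam lam p (tokens (?z @ [a])) = Pi_lam lam p (tokens ?y @ [u, t])"
        by (rule Pi_lam_perm) (use du Inr in auto)
      then have "ltok (set (tokens ?y)) u \<noteq> 0"
        using P Pi_lam_snoc[of lam p "tokens ?y @ [u]" t] Pi_lam_snoc[of lam p "tokens ?y" u] by auto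
      moreover have "k (tokens ?y @ [u]) \<noteq> 0"
        using k_pos[of "tokens ?y @ [u]"] du Inr by auto
      ultimately have "w0 (?y @ [a]) \<noteq> 0"
        using y unfolding w0_snoc Inr fac_Inr by simp
      then show ?thesis
        using \<open>no_taker Tc t ?y\<close> by (simp add: claim_append[of Tc t ?y] Inr del: append_assoc)
    qed
  qed
  then show ?case by simp
qed

text \<open>Each type in \<open>U(R)\<close> is counted once, at the last token of its compatibility set.\<close>

lemma lamU_by_last_token:
  assumes "distinct ts"
  shows "(\<Sum>t\<in>set ts. \<Sum>c | t \<in> Tc c \<and> Tc c \<subseteq> insert t (set (takeWhile (\<lambda>u. u \<noteq> t) ts)). lam c)
    = lamU lam Tc (set ts)"
  using assms
proof (induction ts rule: rev_induct)
  case Nil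
  show ?case using Tc_nonempty by (simp add: lamU_def)
next
  case (snoc u ts)
  have tw: "takeWhile (\<lambda>v. v \<noteq> t) (ts @ [u]) = takeWhile (\<lambda>v. v \<noteq> t) ts" if "t \<in> set ts" for t
    using that by (intro takeWhile_append1) auto
  have tu: "takeWhile (\<lambda>v. v \<noteq> u) (ts @ [u]) = ts"
    using snoc.prems by (subst takeWhile_append2) auto
  have "{c. Tc c \<subseteq> set (ts @ [u])} =
      {c. Tc c \<subseteq> set ts} \<union> {c. u \<in> Tc c \<and> Tc c \<subseteq> insert u (set ts)}"
    by auto
  moreover have "{c. Tc c \<subseteq> set ts} \<inter> {c. u \<in> Tc c \<and> Tc c \<subseteq> insert u (set ts)} = {}"
    using snoc.prems by auto
  ultimately have "lamU lam Tc (set (ts @ [u])) = lamU lam Tc (set ts)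
      + (\<Sum>c | u \<in> Tc c \<and> Tc c \<subseteq> insert u (set ts). lam c)"
    unfolding lamU_def by (simp add: sum.union_disjoint)
  then show ?case
    using snoc tw tu by (simp add: add.commute)
qed

lemma arrival_split: "(\<Sum>t\<in>- R. ltok R t) + lamU lam Tc R = sum lam UNIV"
proof -
  have "(\<Sum>t\<in>- R. p R c t) = (if Tc c \<subseteq> R then 0 else 1)" for c
  proof -
    have "(\<Sum>t\<in>- R. p R c t) = (\<Sum>t\<in>Tc c - R. p R c t)"
      by (rule sum.mono_neutral_right) (auto intro!: p_zero)
    also have "\<dots> = (if Tc c \<subseteq> R then 0 else 1)"
    proof (cases "Tc c \<subseteq> R")
      case True
      then show ?thesis by (simp add: Diff_eq_empty_iff[THEN iffD2])
    next
      case False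
      then show ?thesis using p_sum[of c R] by auto
    qed
    finally show ?thesis .
  qed
  then have "(\<Sum>t\<in>- R. ltok R t) = (\<Sum>c\<in>UNIV. lam c * (if Tc c \<subseteq> R then 0 else 1))"
    unfolding lam_tok_def by (subst sum.swap) (simp flip: sum_distrib_left)
  moreover have "lamU lam Tc R = (\<Sum>c\<in>UNIV. if Tc c \<subseteq> R then lam c else 0)"
    unfolding lamU_def by (simp add: sum.If_cases)
  ultimately have "(\<Sum>t\<in>- R. ltok R t) + lamU lam Tc R
      = (\<Sum>c\<in>UNIV. lam c * (if Tc c \<subseteq> R then 0 else 1) + (if Tc c \<subseteq> R then lam c else 0))"
    by (simp add: sum.distrib)
  also have "\<dots> = sum lam UNIV" by (intro sum.cong) auto
  finally show ?thesis .
qed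

section \<open>The two partial balances of the erased chain\<close>

lemma finite_lists_of_length: "finite {x::('c + 't) list. length x = n}"
  using finite_lists_length_eq[of "UNIV :: ('c + 't) set" n] by simp

text \<open>If \<open>t\<close> is unclaimed in \<open>z\<close>, nobody took it and the queue
  before reassignment was \<open>z\<close> itself. If it is claimed, a customer waiting at that
  place took it, and the relevant queues differ only in its type.\<close>

lemma sum_insertion_sum_token:
  assumes "w0 z \<noteq> 0"
  shows "(\<Sum>y | length y = length z \<and> clm t y = z. insertion_sum t y) =
    (if t \<in> set (tokens z)
     then (\<Sum>c | t \<in> Tc c \<and> Tc c \<subseteq> insert t (set (takeWhile (\<lambda>u. u \<noteq> t) (tokens z))). lam c)
     else ltok (set (tokens z)) t) * w0 z"
proof (cases "t \<in> set (tokens z)")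
  case False
  have nt: "no_taker Tc t z" using assms False by (rule no_taker_w0)
  have "clm t y = z \<longleftrightarrow> y = z" for y
  proof
    assume y: "clm t y = z"
    have "no_taker Tc t y"
      using y False mset_tokens_claim[of Tc t y] by (metis set_mset_mset union_single_eq_member add_mset_add_single)
    then show "y = z" using y by (simp add: claim_no_taker)
  qed (use nt in \<open>simp add: claim_no_taker\<close>)
  then have "{y. length y = length z \<and> clm t y = z} = {z}" by auto
  then show ?thesis using False insertion_sum_free[OF assms False] by simp
next
  case True
  obtain z1 z2 where z: "z = z1 @ Inr t # z2" and t1: "t \<notin> set (tokens z1)"
    using True by (rule tokens_split)
  have tw: "takeWhile (\<lambda>u. u \<noteq> t) (tokens z) = tokens z1"
    using t1 unfolding z by (simp, subst takeWhile_append2) auto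
  have t2: "t \<notin> set (tokens z2)" using w0_distinct[OF assms] by (auto simp: z)
  have "w0 z1 \<noteq> 0" using assms w0_append_zero unfolding z by blast
  then have nt1: "no_taker Tc t z1" using t1 by (rule no_taker_w0)
  let ?f = "\<lambda>c. z1 @ Inl c # z2"
  have "(\<Sum>y | length y = length z \<and> clm t y = z. insertion_sum t y) = (\<Sum>y\<in>?f ` {c. t \<in> Tc c}. insertion_sum t y)"
  proof (rule sum.mono_neutral_right)
    show "finite {y. length y = length z \<and> clm t y = z}"
      by (rule finite_subset[OF _ finite_lists_of_length[of "length z"]]) auto
    show "?f ` {c. t \<in> Tc c} \<subseteq> {y. length y = length z \<and> clm t y = z}"
      using nt1 by (auto simp: z claim_append)
    show "\<forall>y\<in>{y. length y = length z \<and> clm t y = z} - ?f ` {c. t \<in> Tc c}. insertion_sum t y = 0"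
    proof
      fix y assume y: "y \<in> {y. length y = length z \<and> clm t y = z} - ?f ` {c. t \<in> Tc c}"
      have "no_taker Tc t y"
      proof (rule ccontr)
        assume "\<not> no_taker Tc t y"
        then obtain y1 c y2 where yy: "y = y1 @ Inl c # y2" "t \<in> Tc c" "clm t y = y1 @ Inr t # y2"
          by (rule claim_taker_split)
        then have "y1 @ Inr t # y2 = z1 @ Inr t # z2" using y z by auto
        moreover have "Inr t \<notin> set z1" "Inr t \<notin> set z2" using t1 t2 by (auto simp: set_tokens)
        ultimately have "y1 = z1" "y2 = z2"
          by (auto simp: append_eq_append_conv2 append_eq_Cons_conv Cons_eq_append_conv)
        then show False using y yy by auto
      qed
      \<comment> \<open>Without a taker \<open>t\<close> was already held in \<open>y\<close>, so
        inserting it repeats a token.\<close>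
      then have "y = z" using y by (simp add: claim_no_taker)
      then show "insertion_sum t y = 0" using True by (simp add: insertion_sum_taken)
    qed
  qed
  also have "\<dots> = (\<Sum>c | t \<in> Tc c. insertion_sum t (?f c))"
    by (subst sum.reindex) (auto simp: inj_on_def)
  also have "\<dots> = (\<Sum>c | t \<in> Tc c. (if Tc c \<subseteq> insert t (set (tokens z1)) then lam c else 0) * w0 z)"
    using insertion_sum_waiting assms unfolding z by (intro sum.cong) auto
  also have "\<dots> = (\<Sum>c | t \<in> Tc c. if Tc c \<subseteq> insert t (set (tokens z1)) then lam c else 0) * w0 z"
    by (simp add: sum_distrib_right)
  also have "(\<Sum>c | t \<in> Tc c. if Tc c \<subseteq> insert t (set (tokens z1)) then lam c else 0)
     = (\<Sum>c | t \<in> Tc c \<and> Tc c \<subseteq> insert t (set (tokens z1)). lam c)"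
    by (simp add: sum.If_cases Collect_conj_eq)
  finally show ?thesis using True tw by simp
qed

text \<open>Claimed tokens account for the arrivals that must wait, each type counted at its last
  token; available tokens account for the arrivals that claim them.\<close>

lemma sum_insertion_sum:
  assumes "w0 z \<noteq> 0"
  shows "(\<Sum>t\<in>UNIV. \<Sum>y | length y = length z \<and> clm t y = z. insertion_sum t y) = sum lam UNIV * w0 z"
proof -
  let ?R = "set (tokens z)"
  let ?g = "\<lambda>t. \<Sum>c | t \<in> Tc c \<and> Tc c \<subseteq> insert t (set (takeWhile (\<lambda>u. u \<noteq> t) (tokens z))). lam c"
  have "(\<Sum>t\<in>UNIV. \<Sum>y | length y = length z \<and> clm t y = z. insertion_sum t y)
     = (\<Sum>t\<in>UNIV. if t \<in> ?R then ?g t else ltok ?R t) * w0 z"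
    unfolding sum_insertion_sum_token[OF assms] by (simp add: sum_distrib_right)
  also have "(\<Sum>t\<in>UNIV. if t \<in> ?R then ?g t else ltok ?R t) = sum ?g ?R + (\<Sum>t\<in>-?R. ltok ?R t)"
    by (simp add: sum.If_cases)
  also have "\<dots> = sum lam UNIV"
    using lamU_by_last_token[OF w0_distinct[OF assms]] arrival_split[of ?R] by simp
  finally show ?thesis .
qed

text \<open>The factor \<open>eta\<close> is left out: it is the same for all predecessors of a
  state and returns in \<open>wt_balance\<close>. For each \<open>i\<close> at most one
  \<open>t\<close> contributes, the token held there.\<close>

definition dep0 :: "('c + 't) list \<Rightarrow> ('c + 't) list \<Rightarrow> real" where
  "dep0 x z = (\<Sum>i<length x. \<Sum>t\<in>UNIV.
     if x ! i = Inr t \<and> clm t (take i x @ drop (Suc i) x) = z then s (tokens (take (Suc i) x)) else 0)"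

lemma dep0_balance:
  "(\<Sum>x | length x = Suc (length z). w0 x * dep0 x z) = sum lam UNIV * w0 z"
proof (cases "w0 z = 0")
  case True
  have "w0 x * dep0 x z = 0" for x
  proof (cases "w0 x = 0")
    case False
    have "\<not> (x ! i = Inr t \<and> clm t (take i x @ drop (Suc i) x) = z)" if "i < length x" for i t
    proof
      assume a: "x ! i = Inr t \<and> clm t (take i x @ drop (Suc i) x) = z"
      then have "x = take i x @ Inr t # drop (Suc i) x"
        using id_take_nth_drop[OF that] by simp
      then show False using w0_claim_nonzero[of "take i x" t "drop (Suc i) x"] False a True by simp
    qed
    then have "dep0 x z = 0" unfolding dep0_def by (intro sum.neutral ballI) auto
    then show ?thesis by simp
  qed simp
  then have "(\<Sum>x | length x = Suc (length z). w0 x * dep0 x z) = 0" by (intro sum.neutral) blast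
  then show ?thesis using True by simp
next
  case False
  let ?n = "length z"
  let ?Y = "\<lambda>t. {y. length y = ?n \<and> clm t y = z}"
  \<comment> \<open>Deleting the holder at position \<open>i\<close> and inserting it again are
    inverse, so predecessors \<open>x\<close> are traded for the queues \<open>y\<close> between
    departure and reassignment.\<close>
  have one: "(\<Sum>x | length x = Suc ?n.
        if x ! i = Inr t \<and> clm t (take i x @ drop (Suc i) x) = z then w0 x * s (tokens (take (Suc i) x)) else 0)
      = (\<Sum>y\<in>?Y t. w0 (insert_at i t y) * s (tokens (take i y) @ [t]))"
    if i: "i < Suc ?n" for i t
  proof -
    let ?X = "{x. length x = Suc ?n \<and> x ! i = Inr t \<and> clm t (take i x @ drop (Suc i) x) = z}"
    have "(\<Sum>x | length x = Suc ?n.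
        if x ! i = Inr t \<and> clm t (take i x @ drop (Suc i) x) = z then w0 x * s (tokens (take (Suc i) x)) else 0)
      = (\<Sum>x\<in>?X. w0 x * s (tokens (take (Suc i) x)))"
      by (subst sum.inter_filter[symmetric]) (simp_all add: finite_lists_of_length)
    also have "\<dots> = (\<Sum>y\<in>?Y t. w0 (insert_at i t y) * s (tokens (take i y) @ [t]))"
    proof (rule sum.reindex_bij_witness[where i = "\<lambda>y. insert_at i t y" and j = "\<lambda>x. take i x @ drop (Suc i) x"])
      fix x assume x: "x \<in> ?X"
      then have xi: "take i x @ Inr t # drop (Suc i) x = x"
        using id_take_nth_drop[of i x] i by simp
      show e: "insert_at i t (take i x @ drop (Suc i) x) = x"
        using xi x i by (simp add: insert_at_def)
      show "take i x @ drop (Suc i) x \<in> ?Y t" using x i by auto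
      have "take (Suc i) x = take i x @ [Inr t]" using x i by (simp add: take_Suc_conv_app_nth)
      then show "w0 (insert_at i t (take i x @ drop (Suc i) x)) * s (tokens (take i (take i x @ drop (Suc i) x)) @ [t])
          = w0 x * s (tokens (take (Suc i) x))"
        using e x i by simp
    next
      fix y assume y: "y \<in> ?Y t"
      show e: "take i (insert_at i t y) @ drop (Suc i) (insert_at i t y) = y"
        using y i by (simp add: insert_at_def)
      show "insert_at i t y \<in> ?X" using y i e by (auto simp: insert_at_def nth_append)
    qed
    finally show ?thesis .
  qed
  have "(\<Sum>x | length x = Suc ?n. w0 x * dep0 x z)
    = (\<Sum>x | length x = Suc ?n. \<Sum>i<Suc ?n. \<Sum>t\<in>UNIV.
        if x ! i = Inr t \<and> clm t (take i x @ drop (Suc i) x) = z then w0 x * s (tokens (take (Suc i) x)) else 0)"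
    unfolding dep0_def sum_distrib_left mult_delta_right by (intro sum.cong refl) simp
  also have "\<dots> = (\<Sum>i<Suc ?n. \<Sum>t\<in>UNIV. \<Sum>x | length x = Suc ?n.
        if x ! i = Inr t \<and> clm t (take i x @ drop (Suc i) x) = z then w0 x * s (tokens (take (Suc i) x)) else 0)"
    by (subst sum.swap, intro sum.cong[OF refl], rule sum.swap)
  also have "\<dots> = (\<Sum>i<Suc ?n. \<Sum>t\<in>UNIV. \<Sum>y\<in>?Y t. w0 (insert_at i t y) * s (tokens (take i y) @ [t]))"
    by (intro sum.cong[OF refl] one) simp
  also have "\<dots> = (\<Sum>t\<in>UNIV. \<Sum>y\<in>?Y t. \<Sum>i<Suc ?n. w0 (insert_at i t y) * s (tokens (take i y) @ [t]))"
    by (subst sum.swap, intro sum.cong[OF refl], rule sum.swap)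
  also have "\<dots> = (\<Sum>t\<in>UNIV. \<Sum>y\<in>?Y t. insertion_sum t y)"
    unfolding insertion_sum_def by (intro sum.cong refl) (auto simp: lessThan_Suc_atMost)
  finally show ?thesis using sum_insertion_sum[OF False] by simp
qed

definition arr0 :: "('c + 't) list \<Rightarrow> ('c + 't) list \<Rightarrow> real" where
  "arr0 x z = (\<Sum>c\<in>UNIV. if Tc c \<subseteq> set (tokens x) then (if z = x @ [Inl c] then lam c else 0)
     else (\<Sum>t\<in>Tc c - set (tokens x). if z = x @ [Inr t] then lam c * p (set (tokens x)) c t else 0))"

lemma arr0_Nil: "arr0 x [] = 0"
  unfolding arr0_def by (intro sum.neutral ballI) simp

lemma arr0_snoc:
  "arr0 x (z @ [a]) = (if x = z then (case a of Inl c \<Rightarrow> if Tc c \<subseteq> set (tokens z) then lam c else 0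
     | Inr t \<Rightarrow> ltok (set (tokens z)) t) else 0)"
proof (cases "x = z")
  case False
  then show ?thesis unfolding arr0_def by (auto intro!: sum.neutral)
next
  case True
  show ?thesis
  proof (cases a)
    case (Inl c)
    have "arr0 x (z @ [a]) = (\<Sum>d\<in>UNIV. if d = c then (if Tc c \<subseteq> set (tokens z) then lam c else 0) else 0)"
      unfolding arr0_def True Inl by (intro sum.cong) auto
    then show ?thesis by (simp add: True Inl)
  next
    case (Inr t)
    let ?R = "set (tokens z)"
    have "arr0 x (z @ [a]) = (\<Sum>c\<in>UNIV. lam c * p ?R c t)"
      unfolding arr0_def True Inr
    proof (intro sum.cong refl)
      fix c
      have "(\<Sum>u\<in>Tc c - ?R. if z @ [Inr t] = z @ [Inr u] then lam c * p ?R c u else 0)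
          = (if t \<in> Tc c - ?R then lam c * p ?R c t else 0)"
        by (simp add: sum.delta')
      then show "(if Tc c \<subseteq> ?R then if z @ [Inr t] = z @ [Inl c] then lam c else 0
         else \<Sum>u\<in>Tc c - ?R. if z @ [Inr t] = z @ [Inr u] then lam c * p ?R c u else 0) = lam c * p ?R c t"
        using p_zero[of t c ?R] by auto
    qed
    then show ?thesis by (simp add: True Inr lam_tok_def)
  qed
qed

text \<open>The only predecessor by arrival is \<open>z\<close> without its last entry, whose factor
  is its arrival rate divided by \<open>k (tokens z)\<close>.\<close>

lemma arr0_balance: "(\<Sum>x | Suc (length x) = length z. w0 x * arr0 x z) = w0 z * k (tokens z)"
proof (cases z rule: rev_cases)
  case Nil
  then show ?thesis by (simp add: kfun_def)
next
  case (snoc y a)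
  let ?r = "case a of Inl c \<Rightarrow> if Tc c \<subseteq> set (tokens y) then lam c else 0 | Inr t \<Rightarrow> ltok (set (tokens y)) t"
  have "(\<Sum>x | Suc (length x) = length z. w0 x * arr0 x z)
     = (\<Sum>x | length x = length y. if x = y then w0 y * ?r else 0)"
    unfolding snoc arr0_snoc by (intro sum.cong) auto
  also have "\<dots> = w0 y * ?r"
    using finite_lists_of_length[of "length y"] by simp
  also have "\<dots> = w0 z * k (tokens z)"
  proof (cases "w0 y = 0")
    case False
    then have d: "distinct (tokens y)" by (rule w0_distinct)
    show ?thesis
    proof (cases a)
      case (Inl c)
      have "k (tokens y) \<noteq> 0" if "Tc c \<subseteq> set (tokens y)"
        using that Tc_nonempty[of c] k_pos[OF d] by (metis empty_set less_irrefl subset_empty)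
      then show ?thesis by (simp add: snoc w0_snoc Inl fac_Inl)
    next
      case (Inr t)
      have "k (tokens y @ [t]) \<noteq> 0" if "t \<notin> set (tokens y)"
        using that d k_pos[of "tokens y @ [t]"] by simp
      then show ?thesis
        by (cases "t \<in> set (tokens y)") (simp_all add: snoc w0_snoc Inr fac_Inr ltok_unavailable)
    qed
  qed (simp add: snoc w0_snoc)
  finally show ?thesis .
qed

end

subsection \<open>Fixed points with prescribed fibre sums\<close>

text \<open>The box is compact by Tychonoff; the countable index type makes the product topology
  first countable, so compactness yields subsequences.\<close>

lemma compact_pointwise_box:
  fixes B :: "'a::countable \<Rightarrow> real" and X :: "nat \<Rightarrow> 'a \<Rightarrow> real"
  assumes "\<And>n y. 0 \<le> X n y \<and> X n y \<le> B y"
  obtains r m where "strict_mono (r :: nat \<Rightarrow> nat)" "\<And>y. (\<lambda>n. X (r n) y) \<longlonglongrightarrow> m y"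
proof -
  let ?K = "Pi\<^sub>E UNIV (\<lambda>y. {0..B y})"
  have "compactin (product_topology (\<lambda>_. euclidean) UNIV) ?K"
    unfolding compactin_PiE by simp
  then have "compact ?K" by (simp add: euclidean_product_topology)
  then have "seq_compact ?K" by (rule compact_imp_seq_compact)
  moreover have "\<forall>n. X n \<in> ?K" using assms by auto
  ultimately obtain m r where r: "strict_mono (r :: nat \<Rightarrow> nat)" "(X \<circ> r) \<longlonglongrightarrow> m"
    unfolding seq_compact_def by blast
  have "(\<lambda>n. X (r n) y) \<longlonglongrightarrow> m y" for y
  proof -
    have "isCont (\<lambda>f. f y :: real) m"
      using continuous_on_product_coordinates[of y] by (metis continuous_on_eq_continuous_at open_UNIV UNIV_I)
    from isCont_tendsto_compose[OF this r(2)] show ?thesis by (simp add: o_def)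
  qed
  with r(1) that show ?thesis by blast
qed

text \<open>A Markov-Kakutani argument: a limit point of the Cesaro averages of the iterates is fixed.\<close>

lemma fixed_measure_on_fibres:
  fixes E :: "'a::countable \<Rightarrow> 'a \<Rightarrow> real" and e :: "'a \<Rightarrow> 'b" and b :: "'b \<Rightarrow> real"
    and S :: "'a set" and P :: "'a \<Rightarrow> 'a set"
  defines "M \<equiv> {m. (\<forall>y. 0 \<le> m y) \<and> (\<forall>y. y \<notin> S \<longrightarrow> m y = 0) \<and>
                   (\<forall>z. (\<Sum>y | e y = z. m y) = b z)}"
    and "F \<equiv> \<lambda>m y. \<Sum>x\<in>P y. m x * E x y"
  assumes finP: "\<And>y. finite (P y)"
    and fibre: "\<And>z. finite {y. e y = z}"
    and FM: "\<And>m. m \<in> M \<Longrightarrow> F m \<in> M"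
    and m0: "m0 \<in> M"
  shows "\<exists>m\<in>M. F m = m"
proof -
  let ?I = "\<lambda>n. (F ^^ n) m0"
  have IM: "?I n \<in> M" for n by (induction n) (use m0 FM in auto)
  define A where "A n y = (\<Sum>i<Suc n. ?I i y) / real (Suc n)" for n y
  have AM: "A n \<in> M" for n
  proof -
    have "(\<Sum>y | e y = z. A n y) = b z" for z
    proof -
      have "(\<Sum>y | e y = z. A n y) = (\<Sum>i<Suc n. \<Sum>y | e y = z. ?I i y) / real (Suc n)"
        unfolding A_def sum_divide_distrib[symmetric] by (subst sum.swap) simp
      also have "(\<Sum>i<Suc n. \<Sum>y | e y = z. ?I i y) = (\<Sum>i<Suc n. b z)"
        using IM by (intro sum.cong) (auto simp: M_def)
      finally show ?thesis by simp
    qed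
    moreover have "0 \<le> A n y" for y
      unfolding A_def using IM by (intro divide_nonneg_nonneg sum_nonneg) (auto simp: M_def)
    moreover have "A n y = 0" if "y \<notin> S" for y
    proof -
      have "?I i y = 0" for i using IM[of i] that by (simp add: M_def)
      then show ?thesis by (simp add: A_def)
    qed
    ultimately show ?thesis by (auto simp: M_def)
  qed
  \<comment> \<open>Nonnegative entries are bounded by their fibre sum. This is the compact box, and
    also the source of \<open>2 * b (e y)\<close> for the telescoped difference below.\<close>
  have bound: "0 \<le> m y \<and> m y \<le> b (e y)" if "m \<in> M" for m y
  proof -
    have "m y \<le> (\<Sum>y' | e y' = e y. m y')"
      using that by (intro member_le_sum fibre) (auto simp: M_def)
    then show ?thesis using that by (auto simp: M_def)
  qed
  obtain r m where r: "strict_mono (r :: nat \<Rightarrow> nat)" and lim: "\<And>y. (\<lambda>n. A (r n) y) \<longlonglongrightarrow> m y"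
    using compact_pointwise_box[of A "\<lambda>y. b (e y)"] bound AM by blast
  have "m \<in> M"
  proof -
    have "0 \<le> m y" for y
      by (rule LIMSEQ_le_const[OF lim]) (use bound AM in blast)
    moreover have "m y = 0" if "y \<notin> S" for y
    proof -
      have "(\<lambda>n. A (r n) y) = (\<lambda>_. 0)" using AM that by (auto simp: M_def)
      then show ?thesis using lim[of y] LIMSEQ_unique tendsto_const by metis
    qed
    moreover have "(\<Sum>y | e y = z. m y) = b z" for z
    proof -
      \<comment> \<open>Fibres are finite, so the sum passes to the limit and no mass
        escapes.\<close>
      have "(\<lambda>n. \<Sum>y | e y = z. A (r n) y) \<longlonglongrightarrow> (\<Sum>y | e y = z. m y)"
        by (intro tendsto_sum lim)
      moreover have "(\<lambda>n. \<Sum>y | e y = z. A (r n) y) = (\<lambda>_. b z)" using AM by (auto simp: M_def)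
      ultimately show ?thesis using LIMSEQ_unique tendsto_const by metis
    qed
    ultimately show ?thesis by (auto simp: M_def)
  qed
  moreover have "F m = m"
  proof
    fix y
    have FA: "F (A n) y - A n y = (?I (Suc n) y - m0 y) / real (Suc n)" for n
    proof -
      have "F (A n) y = (\<Sum>x\<in>P y. \<Sum>i<Suc n. ?I i x * E x y) / real (Suc n)"
        unfolding F_def A_def 
        by (simp add: sum_divide_distrib sum_distrib_right times_divide_eq_left del: sum.lessThan_Suc of_nat_Suc)
      also have "(\<Sum>x\<in>P y. \<Sum>i<Suc n. ?I i x * E x y) = (\<Sum>i<Suc n. F (?I i) y)"
        unfolding F_def by (rule sum.swap)
      also have "\<dots> = (\<Sum>i<Suc n. ?I (Suc i) y)" by simp
      finally have "F (A n) y - A n y = ((\<Sum>i<Suc n. ?I (Suc i) y) - (\<Sum>i<Suc n. ?I i y)) / real (Suc n)"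
        unfolding A_def by (simp add: diff_divide_distrib)
      also have "(\<Sum>i<Suc n. ?I (Suc i) y) - (\<Sum>i<Suc n. ?I i y) = ?I (Suc n) y - ?I 0 y"
        unfolding sum_subtractf[symmetric] by (rule sum_lessThan_telescope)
      finally show ?thesis by simp
    qed
    have "(\<lambda>n. (?I (Suc n) y - m0 y) / real (Suc n)) \<longlonglongrightarrow> 0"
    proof (rule Lim_null_comparison)
      show "\<forall>\<^sub>F n in sequentially. norm ((?I (Suc n) y - m0 y) / real (Suc n)) \<le> 2 * b (e y) / real (Suc n)"
      proof (intro always_eventually allI)
        fix n
        have "\<bar>?I (Suc n) y - m0 y\<bar> \<le> 2 * b (e y)"
          using bound[OF IM[of "Suc n"], of y] bound[OF m0, of y] by linarith
        then show "norm ((?I (Suc n) y - m0 y) / real (Suc n)) \<le> 2 * b (e y) / real (Suc n)"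
          by (simp add: divide_right_mono)
      qed
      show "(\<lambda>n. 2 * b (e y) / real (Suc n)) \<longlonglongrightarrow> 0"
        using LIMSEQ_Suc[OF lim_const_over_n[of "2 * b (e y)"]] by simp
    qed
    then have "(\<lambda>n. F (A (r n)) y - A (r n) y) \<longlonglongrightarrow> 0"
      unfolding FA using LIMSEQ_subseq_LIMSEQ[OF _ r] by (fastforce simp: o_def)
    moreover have "(\<lambda>n. F (A (r n)) y - A (r n) y) \<longlonglongrightarrow> F m y - m y"
      unfolding F_def by (intro tendsto_intros lim)
    ultimately show "F m y = m y" using LIMSEQ_unique by fastforce
  qed
  ultimately show ?thesis by blast
qed

subsection \<open>Lifting the balanced weight to the detailed chain\<close>

definition erase :: "('c \<times> 't option) list \<Rightarrow> ('c + 't) list" where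
  "erase = map (\<lambda>y. case snd y of None \<Rightarrow> Inl (fst y) | Some t \<Rightarrow> Inr t)"

lemma erase_simps [simp]:
  "erase [] = []" "erase ((c, None) # xs) = Inl c # erase xs" "erase ((c, Some t) # xs) = Inr t # erase xs"
  "erase (xs @ ys) = erase xs @ erase ys" "length (erase xs) = length xs"
  "erase (take n xs) = take n (erase xs)" "erase (drop n xs) = drop n (erase xs)"
  by (simp_all add: erase_def take_map drop_map)

lemma erase_nth: "i < length xs \<Longrightarrow> erase xs ! i = (case snd (xs ! i) of None \<Rightarrow> Inl (fst (xs ! i)) | Some t \<Rightarrow> Inr t)"
  by (simp add: erase_def)

lemma erase_update: "erase (xs[i := y]) = (erase xs)[i := (case snd y of None \<Rightarrow> Inl (fst y) | Some t \<Rightarrow> Inr t)]"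
  by (simp add: erase_def map_update)

lemma active_tokens_erase: "active_tokens xs = tokens (erase xs)"
  by (induction xs) (auto simp: active_tokens_def tokens_def erase_def split: option.splits)

lemma unavail_erase: "unavail xs = set (tokens (erase xs))"
  by (force simp: unavail_def set_tokens erase_def image_iff split: option.splits)

text \<open>The \<open>LEAST\<close> index in \<open>depart\<close> splits the list into a part
  without takers and the first taker, where the recursion of \<open>claim\<close> stops.\<close>

lemma erase_depart:
  assumes k: "snd (xs ! k) = Some t"
  shows "erase (depart Tc xs k) = claim Tc t (take k (erase xs) @ drop (Suc k) (erase xs))"
proof -
  define ys where "ys = take k xs @ drop (Suc k) xs"
  define ok where "ok w \<longleftrightarrow> w < length ys \<and> snd (ys ! w) = None \<and> t \<in> Tc (fst (ys ! w))" for w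
  have d: "depart Tc xs k = (if \<exists>w. ok w then ys[(LEAST w. ok w) := (fst (ys ! (LEAST w. ok w)), Some t)] else ys)"
    unfolding depart_def Let_def ok_def ys_def k option.sel ..
  have e: "erase ys = take k (erase xs) @ drop (Suc k) (erase xs)" by (simp add: ys_def)
  have taker: "ok i \<longleftrightarrow> i < length ys \<and> (\<exists>c. erase ys ! i = Inl c \<and> t \<in> Tc c)" for i
    by (auto simp: ok_def erase_nth split: option.splits)
  have "erase (depart Tc xs k) = claim Tc t (erase ys)"
  proof (cases "\<exists>w. ok w")
    case False
    then have "no_taker Tc t (erase ys)"
      unfolding no_taker_def taker by (metis erase_simps(5) in_set_conv_nth)
    then show ?thesis using False d by (simp add: claim_no_taker)
  next
    case True
    define w where "w = (LEAST w. ok w)"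
    have w: "ok w" using True unfolding w_def by (meson LeastI_ex)
    have less: "\<not> ok v" if "v < w" for v using that not_less_Least unfolding w_def by blast
    obtain c where c: "erase ys ! w = Inl c" "t \<in> Tc c" and wl: "w < length (erase ys)"
      using w taker by auto
    have nt: "no_taker Tc t (take w (erase ys))"
      unfolding no_taker_def
    proof (intro allI impI notI)
      fix c assume "Inl c \<in> set (take w (erase ys))" "t \<in> Tc c"
      then obtain i where "i < w" "erase ys ! i = Inl c" "i < length ys"
        using wl by (auto simp: in_set_conv_nth)
      with less \<open>t \<in> Tc c\<close> show False by (auto simp: taker)
    qed
    have "erase ys = take w (erase ys) @ Inl c # drop (Suc w) (erase ys)"
      using id_take_nth_drop[OF wl] c by simp
    then have "claim Tc t (erase ys) = claim Tc t (take w (erase ys) @ Inl c # drop (Suc w) (erase ys))" by simp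
    also have "\<dots> = take w (erase ys) @ Inr t # drop (Suc w) (erase ys)"
      using nt c by (simp add: claim_append)
    also have "\<dots> = erase (ys[w := (fst (ys ! w), Some t)])"
      using wl by (simp add: erase_update upd_conv_take_nth_drop)
    finally show ?thesis using True d by (simp add: w_def)
  qed
  then show ?thesis by (simp add: e)
qed

lemma finite_fibre: "finite {y :: ('c::finite \<times> 't::finite option) list. erase y = z}"
proof (rule finite_subset)
  show "{y :: ('c \<times> 't option) list. erase y = z} \<subseteq> {y. set y \<subseteq> UNIV \<and> length y = length z}"
    using erase_simps(5) by fastforce
qed (rule finite_lists_length_eq, simp)

lemma length_depart: "k < length xs \<Longrightarrow> Suc (length (depart Tc xs k)) = length xs"
  by (auto simp: depart_def Let_def)

context token_queue
begin

definition wt :: "('c + 't) list \<Rightarrow> real" where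
  "wt z = w0 z * (\<Prod>m\<in>{1..length z}. 1 / eta m)"

definition outr :: "('c + 't) list \<Rightarrow> real" where
  "outr z = sum lam UNIV + eta (length z) * k (tokens z)"

lemma eta_prod_pos: "0 < (\<Prod>m\<in>{1..n}. 1 / eta m)"
  using eta_pos by (intro prod_pos) auto

lemma wt_nonneg: "0 \<le> wt z"
  unfolding wt_def by (intro mult_nonneg_nonneg w0_nonneg less_imp_le[OF eta_prod_pos])

lemma wt_zero_iff: "wt z = 0 \<longleftrightarrow> w0 z = 0"
  unfolding wt_def using less_imp_neq[OF eta_prod_pos[of "length z"]] by simp

lemma lam_sum_pos: "0 < sum lam UNIV"
  by (intro sum_pos) (auto simp: lam_pos)

lemma k_nonneg: "distinct ts \<Longrightarrow> 0 \<le> k ts"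
  using k_pos[of ts] by (cases "ts = []") (auto simp: kfun_def)

lemma outr_pos: "w0 z \<noteq> 0 \<Longrightarrow> 0 < outr z"
proof -
  assume "w0 z \<noteq> 0"
  then have "distinct (tokens z)" by (rule w0_distinct)
  then have "0 \<le> eta (length z) * k (tokens z)"
    using k_nonneg[of "tokens z"] eta_pos[of "length z"]
    by (cases "z = []") (auto simp: kfun_def Suc_le_eq intro!: mult_nonneg_nonneg)
  then show ?thesis using lam_sum_pos by (simp add: outr_def)
qed

abbreviation "arr \<equiv> arr_rate lam Tc p"
abbreviation "dep \<equiv> dep_rate Tc s eta"
abbreviation "Q \<equiv> Qrate lam Tc p s eta"
abbreviation "S \<equiv> reach_det lam Tc p s eta"

section \<open>Rates of the detailed chain summed over fibres\<close>

lemma service_sum: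
  "(\<Sum>i<length xs. if snd (xs ! i) \<noteq> None then s (active_tokens (take (Suc i) xs)) else 0) = k (tokens (erase xs))"
proof (induction xs rule: rev_induct)
  case Nil
  then show ?case by (simp add: kfun_def)
next
  case (snoc x xs)
  have "(\<Sum>i<length xs. if snd ((xs @ [x]) ! i) \<noteq> None then s (active_tokens (take (Suc i) (xs @ [x]))) else 0)
    = (\<Sum>i<length xs. if snd (xs ! i) \<noteq> None then s (active_tokens (take (Suc i) xs)) else 0)"
    by (intro sum.cong) (auto simp: nth_append)
  then show ?case
    using snoc by (cases x; cases "snd x") (auto simp: active_tokens_erase kfun_snoc)
qed

lemma out_rate_erase: "out_rate lam Tc p s eta xs = outr (erase xs)"
proof -
  let ?R = "unavail xs"
  have "(\<Sum>c\<in>UNIV. if Tc c - ?R = {} then lam c else (\<Sum>t\<in>Tc c - ?R. lam c * p ?R c t)) = sum lam UNIV"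
    by (intro sum.cong) (auto simp: p_sum simp flip: sum_distrib_left)
  moreover have "(\<Sum>i<length xs. if snd (xs ! i) \<noteq> None then eta (length xs) * s (active_tokens (take (Suc i) xs)) else 0)
     = eta (length xs) * k (tokens (erase xs))"
    unfolding service_sum[symmetric] sum_distrib_left by (intro sum.cong) auto
  ultimately show ?thesis by (simp add: out_rate_def outr_def)
qed

text \<open>With \<open>sum_fibre_dep\<close> this is strong lumpability: the total rate into a
  fibre sees the source only through its erasure.\<close>

lemma sum_fibre_arr: "(\<Sum>y | erase y = z. arr xs y) = arr0 (erase xs) z"
proof -
  let ?R = "set (tokens (erase xs))"
  have "(\<Sum>y | erase y = z. arr xs y) = (\<Sum>c\<in>UNIV. \<Sum>y | erase y = z. if Tc c - ?R = {}
        then (if y = xs @ [(c, None)] then lam c else 0)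
        else (\<Sum>t\<in>Tc c - ?R. if y = xs @ [(c, Some t)] then lam c * p ?R c t else 0))"
    unfolding arr_rate_def unavail_erase by (rule sum.swap)
  also have "\<dots> = arr0 (erase xs) z"
    unfolding arr0_def
  proof (intro sum.cong refl)
    fix c
    show "(\<Sum>y | erase y = z. if Tc c - ?R = {}
        then (if y = xs @ [(c, None)] then lam c else 0)
        else (\<Sum>t\<in>Tc c - ?R. if y = xs @ [(c, Some t)] then lam c * p ?R c t else 0))
      = (if Tc c \<subseteq> ?R then (if z = erase xs @ [Inl c] then lam c else 0)
        else (\<Sum>t\<in>Tc c - ?R. if z = erase xs @ [Inr t] then lam c * p ?R c t else 0))"
    proof (cases "Tc c \<subseteq> ?R")
      case True
      then have "Tc c - ?R = {}" by blast
      then show ?thesis using True by (simp add: finite_fibre eq_commute[of z])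
    next
      case False
      then have "Tc c - ?R \<noteq> {}" by blast
      then have "(\<Sum>y | erase y = z. if Tc c - ?R = {}
          then (if y = xs @ [(c, None)] then lam c else 0)
          else (\<Sum>t\<in>Tc c - ?R. if y = xs @ [(c, Some t)] then lam c * p ?R c t else 0))
        = (\<Sum>t\<in>Tc c - ?R. \<Sum>y | erase y = z. if y = xs @ [(c, Some t)] then lam c * p ?R c t else 0)"
        by (simp only: if_False, subst sum.swap) simp
      then show ?thesis using False by (simp add: finite_fibre eq_commute[of z])
    qed
  qed
  finally show ?thesis .
qed

lemma sum_fibre_dep: "(\<Sum>y | erase y = z. dep xs y) = eta (length xs) * dep0 (erase xs) z"
proof -
  have "(\<Sum>y | erase y = z. dep xs y) = (\<Sum>i<length xs. \<Sum>y | erase y = z.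
      if snd (xs ! i) \<noteq> None \<and> depart Tc xs i = y
      then eta (length xs) * s (active_tokens (take (Suc i) xs)) else 0)"
    unfolding dep_rate_def by (rule sum.swap)
  also have "\<dots> = (\<Sum>i<length xs. eta (length xs) * (\<Sum>t\<in>UNIV.
     if erase xs ! i = Inr t \<and> clm t (take i (erase xs) @ drop (Suc i) (erase xs)) = z
     then s (tokens (take (Suc i) (erase xs))) else 0))"
  proof (intro sum.cong refl)
    fix i assume i: "i \<in> {..<length xs}"
    show "(\<Sum>y | erase y = z. if snd (xs ! i) \<noteq> None \<and> depart Tc xs i = y
        then eta (length xs) * s (active_tokens (take (Suc i) xs)) else 0)
      = eta (length xs) * (\<Sum>t\<in>UNIV.
         if erase xs ! i = Inr t \<and> clm t (take i (erase xs) @ drop (Suc i) (erase xs)) = z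
         then s (tokens (take (Suc i) (erase xs))) else 0)"
    proof (cases "snd (xs ! i)")
      case None
      then show ?thesis using i by (simp add: erase_nth)
    next
      case (Some t)
      have "(\<Sum>y | erase y = z. if snd (xs ! i) \<noteq> None \<and> depart Tc xs i = y
          then eta (length xs) * s (active_tokens (take (Suc i) xs)) else 0)
        = (if erase (depart Tc xs i) = z then eta (length xs) * s (active_tokens (take (Suc i) xs)) else 0)"
        using Some by (simp add: finite_fibre)
      moreover have "(\<Sum>u\<in>UNIV. if erase xs ! i = Inr u \<and> clm u (take i (erase xs) @ drop (Suc i) (erase xs)) = z
          then s (tokens (take (Suc i) (erase xs))) else 0)
        = (\<Sum>u\<in>UNIV. if t = u then (if clm t (take i (erase xs) @ drop (Suc i) (erase xs)) = z
            then s (tokens (take (Suc i) (erase xs))) else 0) else 0)"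
        using i Some by (intro sum.cong) (auto simp: erase_nth)
      ultimately show ?thesis
        using erase_depart[OF Some, of Tc] by (simp add: active_tokens_erase)
    qed
  qed
  finally show ?thesis by (simp add: dep0_def sum_distrib_left)
qed

lemma arr_nonneg: "0 \<le> arr x y"
  unfolding arr_rate_def
  using p_nonneg less_imp_le[OF lam_pos] by (fastforce intro: sum_nonneg)

lemma dep_nonneg:
  assumes "w0 (erase x) \<noteq> 0"
  shows "0 \<le> dep x y"
  unfolding dep_rate_def
proof (intro sum_nonneg)
  fix i assume i: "i \<in> {..<length x}"
  have "tokens (erase x) = tokens (take (Suc i) (erase x)) @ tokens (drop (Suc i) (erase x))"
    by (simp flip: tokens_simps)
  then have "distinct (tokens (take (Suc i) (erase x)))"
    using w0_distinct[OF assms] by (metis distinct_append)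
  then show "0 \<le> (if snd (x ! i) \<noteq> None \<and> depart Tc x i = y
      then eta (length x) * s (active_tokens (take (Suc i) x)) else 0)"
    using eta_pos[of "length x"] i s_nonneg
    by (cases "x = []") (auto simp: active_tokens_erase Suc_le_eq)
qed

lemma arr_length: "arr x y \<noteq> 0 \<Longrightarrow> length y = Suc (length x)"
  unfolding arr_rate_def by (auto elim!: sum.not_neutral_contains_not_neutral split: if_splits)

lemma dep_length: "dep x y \<noteq> 0 \<Longrightarrow> Suc (length y) = length x"
  unfolding dep_rate_def
  by (auto elim!: sum.not_neutral_contains_not_neutral simp: length_depart split: if_splits)

lemma arr0_length: "arr0 x z \<noteq> 0 \<Longrightarrow> length z = Suc (length x)"
  by (cases z rule: rev_cases) (auto simp: arr0_Nil arr0_snoc split: if_splits)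

lemma dep0_length: "dep0 x z \<noteq> 0 \<Longrightarrow> Suc (length z) = length x"
  unfolding dep0_def by (auto elim!: sum.not_neutral_contains_not_neutral split: if_splits)

section \<open>Support of the weight and reachable states\<close>

lemma arr0_nonneg: "0 \<le> arr0 x z"
  unfolding arr0_def
  using p_nonneg less_imp_le[OF lam_pos] by (fastforce intro: sum_nonneg)

lemma dep0_nonneg:
  assumes "w0 x \<noteq> 0"
  shows "0 \<le> dep0 x z"
  unfolding dep0_def
proof (intro sum_nonneg)
  fix i t
  have "tokens x = tokens (take (Suc i) x) @ tokens (drop (Suc i) x)"
    by (simp flip: tokens_simps)
  then have "distinct (tokens (take (Suc i) x))"
    using w0_distinct[OF assms] by (metis distinct_append)
  then show "0 \<le> (if x ! i = Inr t \<and> clm t (take i x @ drop (Suc i) x) = z then s (tokens (take (Suc i) x)) else 0)"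
    using s_nonneg by auto
qed

text \<open>A jump of positive rate from a state of positive weight is a positive term in a partial
  balance whose other side is a multiple of the weight of the target.\<close>

lemma w0_reachable:
  assumes "y \<in> S"
  shows "w0 (erase y) \<noteq> 0"
proof -
  have "(\<lambda>a b. 0 < Q a b)\<^sup>*\<^sup>* [] y" using assms by (simp add: reach_det_def)
  then show ?thesis
  proof induction
    case (step x y)
    have x: "0 < w0 (erase x)" using step.IH w0_nonneg[of "erase x"] by simp
    consider "0 < arr x y" | "0 < dep x y" using step.hyps(2) unfolding Qrate_def by linarith
    then show ?case
    proof cases
      case 1
      have "arr x y \<le> arr0 (erase x) (erase y)"
        unfolding sum_fibre_arr[symmetric] by (rule member_le_sum) (auto simp: arr_nonneg finite_fibre)
      then have pos: "0 < w0 (erase x) * arr0 (erase x) (erase y)" using 1 x by simp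
      also have "\<dots> \<le> (\<Sum>z | Suc (length z) = length (erase y). w0 z * arr0 z (erase y))"
      proof (rule member_le_sum[of "erase x"])
        show "finite {z :: ('c + 't) list. Suc (length z) = length (erase y)}"
          by (rule finite_subset[OF _ finite_lists_of_length[of "length y - 1"]]) auto
      qed (use arr_length[of x y] 1 in \<open>auto intro!: mult_nonneg_nonneg w0_nonneg arr0_nonneg\<close>)
      finally show ?thesis unfolding arr0_balance by auto
    next
      case 2
      have l: "Suc (length y) = length x" by (rule dep_length) (use 2 in simp)
      have "dep x y \<le> eta (length x) * dep0 (erase x) (erase y)"
        unfolding sum_fibre_dep[symmetric]
        by (rule member_le_sum) (auto simp: dep_nonneg finite_fibre step.IH)
      moreover have "0 < eta (length x)" by (rule eta_pos) (use l in simp)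
      ultimately have "0 < dep0 (erase x) (erase y)"
        using 2 by (meson less_le_trans zero_less_mult_pos)
      then have pos: "0 < w0 (erase x) * dep0 (erase x) (erase y)" using x by simp
      also have "\<dots> \<le> (\<Sum>z | length z = Suc (length (erase y)). w0 z * dep0 z (erase y))"
      proof (rule member_le_sum[of "erase x"])
        fix z
        show "0 \<le> w0 z * dep0 z (erase y)"
          by (cases "w0 z = 0") (auto intro!: mult_nonneg_nonneg w0_nonneg dep0_nonneg)
      qed (use l in \<open>auto simp: finite_lists_of_length\<close>)
      finally show ?thesis unfolding dep0_balance by auto
    qed
  qed simp
qed

lemma reachable_step: "x \<in> S \<Longrightarrow> 0 < Q x y \<Longrightarrow> y \<in> S"
  unfolding reach_det_def by (auto intro: rtranclp.rtrancl_into_rtrancl)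

text \<open>Arrivals alone suffice: a nonzero factor of \<open>w0\<close> comes from a nonzero
  arrival rate, so the customers can enter one after the other.\<close>

lemma reachable_of_w0:
  assumes "w0 z \<noteq> 0"
  shows "\<exists>y\<in>S. erase y = z"
  using assms
proof (induction z rule: rev_induct)
  case Nil
  have "[] \<in> S" by (simp add: reach_det_def)
  then show ?case by force
next
  case (snoc a z)
  then obtain x where x: "x \<in> S" "erase x = z" by (auto simp: w0_snoc)
  have "arr0 z (z @ [a]) \<noteq> 0"
    using snoc.prems lam_pos
    by (cases a) (auto simp: w0_snoc fac_Inl fac_Inr arr0_snoc less_imp_neq[symmetric] split: if_splits)
  then have "(\<Sum>y | erase y = z @ [a]. arr x y) \<noteq> 0" by (simp add: sum_fibre_arr x)
  then obtain y where y: "erase y = z @ [a]" "arr x y \<noteq> 0"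
    by (auto elim: sum.not_neutral_contains_not_neutral)
  have "0 < Q x y"
    using y(2) arr_nonneg[of x y] dep_nonneg[OF w0_reachable[OF x(1)], of y] by (simp add: Qrate_def)
  then show ?case using reachable_step x(1) y(1) by blast
qed

text \<open>Every event changes the number of customers by one, so this finite set contains all
  predecessors. It depends only on the length and is thus compatible with erasure.\<close>

definition neighbours :: "'x list \<Rightarrow> 'x list set" where
  "neighbours y = {x. length x = Suc (length y) \<or> Suc (length x) = length y}"

lemma Q_neighbours: "Q x y \<noteq> 0 \<Longrightarrow> x \<in> neighbours y"
  using arr_length[of x y] dep_length[of x y]
  by (cases "arr x y = 0") (simp_all add: Qrate_def neighbours_def)

lemma finite_neighbours: "finite (neighbours (y :: 'x::finite list))"
proof (rule finite_subset)
  show "neighbours y \<subseteq> {x. set x \<subseteq> UNIV \<and> length x \<le> Suc (length y)}" by (auto simp: neighbours_def)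
qed (rule finite_lists_length_le, simp)

section \<open>Global balance and its lift\<close>

lemma eta_prod_Suc: "(\<Prod>m\<in>{1..Suc n}. 1 / eta m) * eta (Suc n) = (\<Prod>m\<in>{1..n}. 1 / eta m)"
  using eta_pos[of "Suc n"] by (simp add: prod.nat_ivl_Suc')

text \<open>Add the two partial balances. For predecessors with one more customer \<open>eta\<close>
  cancels the last factor of the product; for those with one fewer the missing factor appears as
  \<open>eta ?n\<close> and turns \<open>k\<close> into the full service rate.\<close>

lemma wt_balance:
  "(\<Sum>x\<in>neighbours z. wt x * (arr0 x z + eta (length x) * dep0 x z)) = wt z * outr z"
proof -
  let ?n = "length z"
  let ?U = "{x :: ('c + 't) list. length x = Suc ?n}" and ?D = "{x :: ('c + 't) list. Suc (length x) = ?n}"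
  have fD: "finite ?D"
    by (rule finite_subset[OF _ finite_lists_of_length[of "?n - 1"]]) auto
  have "(\<Sum>x\<in>neighbours z. wt x * (arr0 x z + eta (length x) * dep0 x z))
      = (\<Sum>x\<in>?U. wt x * (arr0 x z + eta (length x) * dep0 x z))
      + (\<Sum>x\<in>?D. wt x * (arr0 x z + eta (length x) * dep0 x z))"
  proof -
    have U: "neighbours z = ?U \<union> ?D" by (auto simp: neighbours_def)
    have "?U \<inter> ?D = {}" by auto
    then show ?thesis unfolding U by (rule sum.union_disjoint[OF finite_lists_of_length fD])
  qed
  also have "(\<Sum>x\<in>?U. wt x * (arr0 x z + eta (length x) * dep0 x z))
      = (\<Sum>x\<in>?U. w0 x * dep0 x z) * (\<Prod>m\<in>{1..?n}. 1 / eta m)"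
    unfolding sum_distrib_right
  proof (intro sum.cong refl)
    fix x assume x: "x \<in> ?U"
    then have "arr0 x z = 0" using arr0_length[of x z] by auto
    then show "wt x * (arr0 x z + eta (length x) * dep0 x z) = w0 x * dep0 x z * (\<Prod>m\<in>{1..?n}. 1 / eta m)"
      using x eta_prod_Suc[of ?n] by (simp add: wt_def mult_ac del: prod.cl_ivl_Suc)
  qed
  also have "(\<Sum>x\<in>?D. wt x * (arr0 x z + eta (length x) * dep0 x z))
      = (\<Sum>x\<in>?D. w0 x * arr0 x z) * ((\<Prod>m\<in>{1..?n}. 1 / eta m) * eta ?n)"
    unfolding sum_distrib_right
  proof (intro sum.cong refl)
    fix x assume x: "x \<in> ?D"
    then have l: "?n = Suc (length x)" by auto
    then have "dep0 x z = 0" using dep0_length[of x z] by auto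
    then show "wt x * (arr0 x z + eta (length x) * dep0 x z)
        = w0 x * arr0 x z * ((\<Prod>m\<in>{1..?n}. 1 / eta m) * eta ?n)"
      unfolding l eta_prod_Suc by (simp add: wt_def)
  qed
  finally show ?thesis
    unfolding dep0_balance arr0_balance by (simp add: wt_def outr_def algebra_simps)
qed

lemma ex_balanced_lift:
  obtains m where "\<And>y. 0 \<le> m y" "\<And>y. y \<notin> S \<Longrightarrow> m y = 0"
    "\<And>z. (\<Sum>y | erase y = z. m y) = wt z"
    "\<And>y. y \<in> S \<Longrightarrow> m y * outr (erase y) = (\<Sum>x\<in>neighbours y. m x * Q x y)"
proof -
  define M where "M = {m. (\<forall>y. 0 \<le> m y) \<and> (\<forall>y. y \<notin> S \<longrightarrow> m y = 0) \<and>
                   (\<forall>z. (\<Sum>y | erase y = z. m y) = wt z)}"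
  \<comment> \<open>Division is by the rate of leaving the target. That rate is constant on fibres,
    so \<open>wt_balance\<close> preserves the fibre sums, and a fixed point satisfies global
    balance directly.\<close>
  define F where "F m y = (\<Sum>x\<in>neighbours y. m x * (Q x y / outr (erase y)))"
    for m :: "('c \<times> 't option) list \<Rightarrow> real" and y
  have FM: "F m \<in> M" if m: "m \<in> M" for m
  proof -
    have mS: "x \<in> S" if "m x \<noteq> 0" for x using m that by (auto simp: M_def)
    have Q0: "0 \<le> Q x y" if "x \<in> S" for x y
      using arr_nonneg dep_nonneg[OF w0_reachable[OF that]] by (simp add: Qrate_def)
    \<comment> \<open>The reachable set is closed under jumps of positive rate, so no mass flows out
      of it.\<close>
    have zero: "m x * Q x y = 0" if "y \<notin> S" for x y
    proof (rule ccontr)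
      assume "m x * Q x y \<noteq> 0"
      then have "x \<in> S" "Q x y \<noteq> 0" using mS by auto
      then have "0 < Q x y" using Q0[of x y] by simp
      then show False using reachable_step \<open>x \<in> S\<close> that by blast
    qed
    have "0 \<le> F m y" for y
    proof (cases "y \<in> S")
      case True
      have "0 \<le> m x * Q x y" for x
        using mS[of x] Q0[of x y] m by (cases "m x = 0") (auto simp: M_def)
      then show ?thesis
        unfolding F_def times_divide_eq_right
        using outr_pos[OF w0_reachable[OF True]] by (intro sum_nonneg divide_nonneg_pos) auto
    next
      case False
      then show ?thesis unfolding F_def times_divide_eq_right by (simp add: zero)
    qed
    moreover have "F m y = 0" if "y \<notin> S" for y
      unfolding F_def times_divide_eq_right using that by (simp add: zero)
    moreover have "(\<Sum>y | erase y = z. F m y) = wt z" for z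
    proof -
      let ?N = "neighbours z" and ?h = "\<lambda>x. arr0 x z + eta (length x) * dep0 x z"
      let ?P = "{x. erase x \<in> ?N}"
      have P: "neighbours y = ?P" if "erase y = z" for y
        using that by (auto simp: neighbours_def)
      have fP: "finite ?P"
      proof (rule finite_subset)
        show "?P \<subseteq> {x. set x \<subseteq> UNIV \<and> length x \<le> Suc (length z)}" by (auto simp: neighbours_def)
      qed (rule finite_lists_length_le, simp)
      have "(\<Sum>y | erase y = z. F m y) = (\<Sum>y | erase y = z. \<Sum>x\<in>?P. m x * Q x y) / outr z"
        unfolding sum_divide_distrib F_def by (intro sum.cong) (auto simp: P)
      also have "(\<Sum>y | erase y = z. \<Sum>x\<in>?P. m x * Q x y) = (\<Sum>x\<in>?P. m x * ?h (erase x))"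
        by (subst sum.swap)
          (simp add: Qrate_def sum.distrib sum_fibre_arr sum_fibre_dep flip: sum_distrib_left)
      also have "\<dots> = (\<Sum>x'\<in>?N. \<Sum>x | x \<in> ?P \<and> erase x = x'. m x * ?h (erase x))"
        by (rule sum.group[symmetric, OF fP]) (auto intro: finite_neighbours)
      also have "\<dots> = (\<Sum>x'\<in>?N. wt x' * ?h x')"
      proof (intro sum.cong refl)
        fix x' assume "x' \<in> ?N"
        then have "{x. x \<in> ?P \<and> erase x = x'} = {x. erase x = x'}" by auto
        then have "(\<Sum>x | x \<in> ?P \<and> erase x = x'. m x * ?h (erase x)) = (\<Sum>x | erase x = x'. m x) * ?h x'"
          by (simp add: sum_distrib_right)
        then show "(\<Sum>x | x \<in> ?P \<and> erase x = x'. m x * ?h (erase x)) = wt x' * ?h x'"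
          using m by (simp add: M_def)
      qed
      also have "\<dots> = wt z * outr z" by (rule wt_balance)
      finally show ?thesis
        using outr_pos[of z] wt_zero_iff[of z] by (cases "w0 z = 0") auto
    qed
    ultimately show ?thesis by (auto simp: M_def)
  qed
  \<comment> \<open>\<open>M\<close> is nonempty: the whole weight of a fibre is put on one
    reachable representative.\<close>
  define rep where "rep z = (SOME y. y \<in> S \<and> erase y = z)" for z
  have rep: "rep z \<in> S \<and> erase (rep z) = z" if "w0 z \<noteq> 0" for z
    unfolding rep_def using someI_ex[of "\<lambda>y. y \<in> S \<and> erase y = z"] reachable_of_w0[OF that] by blast
  define m0 where "m0 y = (if w0 (erase y) \<noteq> 0 \<and> y = rep (erase y) then wt (erase y) else 0)" for y
  have m0: "m0 \<in> M"
  proof -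
    have "(\<Sum>y | erase y = z. m0 y) = wt z" for z
    proof (cases "w0 z = 0")
      case True
      then show ?thesis by (simp add: m0_def wt_zero_iff)
    next
      case False
      have "(\<Sum>y | erase y = z. m0 y) = (\<Sum>y | erase y = z. if y = rep z then wt z else 0)"
        using False by (intro sum.cong) (auto simp: m0_def)
      then show ?thesis using rep[OF False] by (simp add: finite_fibre)
    qed
    moreover have "m0 y = 0" if "y \<notin> S" for y
      using rep[of "erase y"] that by (auto simp: m0_def)
    ultimately show ?thesis by (auto simp: M_def m0_def wt_nonneg)
  qed
  have Fe: "F = (\<lambda>m y. \<Sum>x\<in>neighbours y. m x * (Q x y / outr (erase y)))"
    by (intro ext) (simp add: F_def)
  have "\<exists>m\<in>M. F m = m"
    unfolding M_def Fe
    by (rule fixed_measure_on_fibres[OF finite_neighbours finite_fibre FM[unfolded M_def Fe] m0[unfolded M_def]])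
  then obtain m where m: "m \<in> M" "F m = m" by blast
  show ?thesis
  proof
    show "m y * outr (erase y) = (\<Sum>x\<in>neighbours y. m x * Q x y)" if "y \<in> S" for y
    proof -
      have "m y = (\<Sum>x\<in>neighbours y. m x * Q x y) / outr (erase y)"
        using fun_cong[OF m(2), of y] by (simp add: F_def sum_divide_distrib)
      then show ?thesis using outr_pos[OF w0_reachable[OF that]] by (simp add: field_simps)
    qed
  qed (use m(1) in \<open>auto simp: M_def\<close>)
qed

end

subsection \<open>Aggregated states\<close>

definition aggz_step :: "('t \<times> nat) list \<Rightarrow> 'c + 't \<Rightarrow> ('t \<times> nat) list" where
  "aggz_step x a = (case a of
       Inr t \<Rightarrow> x @ [(t, 0)]
     | Inl _ \<Rightarrow> (if x = [] then [] else butlast x @ [(fst (last x), Suc (snd (last x)))]))"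

definition aggz :: "('c + 't) list \<Rightarrow> ('t \<times> nat) list" where
  "aggz z = foldl aggz_step [] z"

lemma aggz_Nil [simp]: "aggz [] = []"
  and aggz_snoc: "aggz (z @ [a]) = aggz_step (aggz z) a"
  by (simp_all add: aggz_def)

lemma aggr_erase: "aggr xs = aggz (erase xs)"
proof (induction xs rule: rev_induct)
  case (snoc y xs)
  then show ?case
    by (cases y; cases "snd y") (auto simp: aggr_def aggz_snoc agg_step_def aggz_step_def)
qed (simp add: aggr_def)

definition size_agg :: "('t \<times> nat) list \<Rightarrow> nat" where
  "size_agg x = length x + sum_list (map snd x)"

lemma size_agg_snoc: "size_agg (x @ [(t, n)]) = size_agg x + Suc n"
  by (simp add: size_agg_def)

lemma map_fst_aggz: "map fst (aggz z) = tokens z"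
proof (induction z rule: rev_induct)
  case (snoc a z)
  have "map fst (butlast x @ [(fst (last x), m)]) = map fst x" if "x \<noteq> []" for x m
    using that by (cases x rule: rev_cases) auto
  from this[of "aggz z"] snoc show ?case
    by (cases a) (auto simp: aggz_snoc aggz_step_def)
qed simp

text \<open>\<open>aggz\<close> drops customers waiting ahead of all token holders. The length
  condition excludes such lists, which makes the set finite; by \<open>w0_states_of\<close> only
  states of weight 0 are lost.\<close>

definition states_of :: "('t \<times> nat) list \<Rightarrow> ('c + 't) list set" where
  "states_of x = {z. aggz z = x \<and> length z = size_agg x}"

lemma states_of_Nil: "states_of [] = {[]}"
  by (auto simp: states_of_def size_agg_def)

lemma states_of_active:
  fixes x :: "('t \<times> nat) list"
  shows "(states_of (x @ [(t, 0)]) :: ('c + 't) list set) = (\<lambda>z. z @ [Inr t]) ` states_of x"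
proof (intro subset_antisym subsetI)
  fix z :: "('c + 't) list" assume z: "z \<in> states_of (x @ [(t, 0)])"
  then obtain y a where y: "z = y @ [a]"
    by (cases z rule: rev_cases) (auto simp: states_of_def)
  with z have "aggz_step (aggz y) a = x @ [(t, 0)]" "length y = size_agg x"
    by (auto simp: states_of_def aggz_snoc size_agg_snoc)
  then show "z \<in> (\<lambda>z. z @ [Inr t]) ` states_of x"
    unfolding y by (cases a) (auto simp: aggz_step_def states_of_def split: if_splits)
qed (auto simp: states_of_def aggz_snoc aggz_step_def size_agg_snoc)

lemma states_of_waiting:
  fixes x :: "('t \<times> nat) list"
  shows "(states_of (x @ [(t, Suc n)]) :: ('c + 't) list set) = (\<lambda>(z, c). z @ [Inl c]) ` (states_of (x @ [(t, n)]) \<times> UNIV)"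
proof (intro subset_antisym subsetI)
  fix z :: "('c + 't) list" assume z: "z \<in> states_of (x @ [(t, Suc n)])"
  then obtain y a where y: "z = y @ [a]"
    by (cases z rule: rev_cases) (auto simp: states_of_def)
  with z have s: "aggz_step (aggz y) a = x @ [(t, Suc n)]" and l: "length y = size_agg (x @ [(t, n)])"
    by (auto simp: states_of_def aggz_snoc size_agg_snoc)
  from s obtain c where c: "a = Inl c" by (cases a) (auto simp: aggz_step_def)
  with s have "aggz y = x @ [(t, n)]"
    by (cases "aggz y" rule: rev_cases) (auto simp: aggz_step_def)
  with l have "y \<in> states_of (x @ [(t, n)])" by (simp add: states_of_def)
  then show "z \<in> (\<lambda>(z, c). z @ [Inl c]) ` (states_of (x @ [(t, n)]) \<times> UNIV)"
    unfolding y c by force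
qed (auto simp: states_of_def aggz_snoc aggz_step_def size_agg_snoc)

lemma finite_states_of: "finite (states_of x :: ('c::finite + 't::finite) list set)"
  by (rule finite_subset[OF _ finite_lists_length_eq[of UNIV "size_agg x"]])
     (auto simp: states_of_def)

section \<open>From erased weights to the aggregated law\<close>

context token_queue
begin

definition weight0 :: "('t \<times> nat) list \<Rightarrow> real" where
  "weight0 x = Pi_lam lam p (map fst x) / Pi_k s (map fst x)
     * (\<Prod>j<length x. alpha lam Tc s (map fst x) (Suc j) ^ snd (x ! j))"

lemma weight0_snoc:
  "weight0 (x @ [(t, n)]) = weight0 x * (ltok (set (map fst x)) t / k (map fst x @ [t]))
     * (lamU lam Tc (set (map fst x @ [t])) / k (map fst x @ [t])) ^ n"
proof -
  let ?ts = "map fst x @ [t]"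
  have "(\<Prod>j<length x. alpha lam Tc s ?ts (Suc j) ^ snd ((x @ [(t, n)]) ! j))
      = (\<Prod>j<length x. alpha lam Tc s (map fst x) (Suc j) ^ snd (x ! j))"
    by (intro prod.cong) (auto simp: nth_append alpha_def)
  then have "weight0 (x @ [(t, n)]) = Pi_lam lam p ?ts / Pi_k s ?ts
      * ((\<Prod>j<length x. alpha lam Tc s (map fst x) (Suc j) ^ snd (x ! j))
         * alpha lam Tc s ?ts (Suc (length x)) ^ n)"
    by (simp add: weight0_def)
  then show ?thesis
    by (simp add: weight0_def Pi_lam_snoc Pi_k_snoc alpha_def mult_ac)
qed

lemma weight_eq: "weight lam Tc p s eta x = weight0 x * (\<Prod>m\<in>{1..size_agg x}. 1 / eta m)"
proof -
  have "(\<Prod>j<length x. alpha lam Tc s (map fst x) (Suc j) ^ (map snd x ! j))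
    = (\<Prod>j<length x. alpha lam Tc s (map fst x) (Suc j) ^ snd (x ! j))"
    by (intro prod.cong) auto
  then show ?thesis by (simp add: weight_def Let_def weight0_def size_agg_def)
qed

text \<open>Induct on the pairs (T_j, n_j), and inside a pair on n_j. One more waiting customer
  multiplies the sum by its factor summed over all types, which is alpha for the current
  tokens.\<close>

lemma sum_w0_states_of: "(\<Sum>z\<in>states_of x. w0 z) = weight0 x"
proof (induction x rule: rev_induct)
  case Nil
  show ?case by (simp add: states_of_Nil weight0_def Pi_lam_def Pi_k_def)
next
  case (snoc y x)
  obtain t n where y: "y = (t, n)" by (cases y)
  let ?ts = "map fst x @ [t]"
  have tokens: "tokens z = map fst x'" if "z \<in> states_of x'" for z :: "('c + 't) list" and x'
    using that map_fst_aggz[of z] by (simp add: states_of_def)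
  have "(\<Sum>z\<in>states_of (x @ [(t, n)]). w0 z) = weight0 (x @ [(t, n)])"
  proof (induction n)
    case 0
    have "(\<Sum>z\<in>states_of (x @ [(t, 0)]). w0 z) = (\<Sum>z\<in>states_of x. w0 (z @ [Inr t]))"
      unfolding states_of_active by (subst sum.reindex) (auto simp: inj_on_def)
    also have "\<dots> = (\<Sum>z\<in>states_of x. w0 z) * fac (map fst x) (Inr t)"
      unfolding sum_distrib_right by (intro sum.cong) (auto simp: w0_snoc tokens)
    finally show ?case
      by (simp add: snoc.IH weight0_snoc fac_Inr)
  next
    case (Suc n)
    have "(\<Sum>z\<in>states_of (x @ [(t, Suc n)]). w0 z)
       = (\<Sum>(z, c)\<in>states_of (x @ [(t, n)]) \<times> UNIV. w0 (z @ [Inl c]))"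
      unfolding states_of_waiting by (subst sum.reindex) (auto simp: inj_on_def case_prod_unfold)
    also have "\<dots> = (\<Sum>(z, c)\<in>states_of (x @ [(t, n)]) \<times> UNIV. w0 z * fac ?ts (Inl c))"
      by (intro sum.cong) (auto simp: w0_snoc tokens)
    also have "\<dots> = (\<Sum>z\<in>states_of (x @ [(t, n)]). w0 z) * (\<Sum>c\<in>UNIV. fac ?ts (Inl c))"
      by (simp add: sum_product sum.cartesian_product)
    also have "(\<Sum>c\<in>UNIV. fac ?ts (Inl c)) = lamU lam Tc (set ?ts) / k ?ts"
      by (simp add: fac_Inl lamU_def sum.If_cases sum_divide_distrib)
    finally show ?case
      by (simp add: Suc.IH weight0_snoc mult_ac)
  qed
  then show ?case by (simp add: y)
qed

lemma sum_wt_states_of: "(\<Sum>z\<in>states_of x. wt z) = weight lam Tc p s eta x"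
  unfolding weight_eq sum_w0_states_of[symmetric] sum_distrib_right
  by (intro sum.cong) (auto simp: wt_def states_of_def)

text \<open>Compatibility sets are nonempty, so with nonzero weight nobody waits ahead of all token
  holders and aggregation drops no one.\<close>

lemma w0_states_of: "w0 z \<noteq> 0 \<Longrightarrow> z \<in> states_of (aggz z)"
proof (induction z rule: rev_induct)
  case (snoc a z)
  then have IH: "length z = size_agg (aggz z)" by (simp add: w0_snoc states_of_def)
  show ?case
  proof (cases a)
    case (Inr t)
    then show ?thesis using IH by (simp add: states_of_def aggz_snoc aggz_step_def size_agg_snoc)
  next
    case (Inl c)
    have "Tc c \<subseteq> set (tokens z)" using snoc.prems by (auto simp: w0_snoc Inl fac_Inl split: if_splits)
    then have "tokens z \<noteq> []" using Tc_nonempty[of c] by auto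
    then have "aggz z \<noteq> []" using map_fst_aggz[of z] by auto
    then obtain x t n where "aggz z = x @ [(t, n)]" by (metis rev_exhaust surj_pair)
    then show ?thesis using IH Inl
      by (simp add: states_of_def aggz_snoc aggz_step_def size_agg_snoc)
  qed
qed (simp add: states_of_def size_agg_def)

lemma weight_nonneg: "0 \<le> weight lam Tc p s eta x"
  unfolding sum_wt_states_of[symmetric] by (intro sum_nonneg wt_nonneg)

lemma stationary_distribution:
  assumes summable: "weight lam Tc p s eta summable_on {x. distinct (map fst x)}"
  shows "\<exists>pr. stationary lam Tc p s eta pr \<and>
           (\<forall>x\<in>reach_agg lam Tc p s eta.
              (\<Sum>y\<in>{y\<in>S. aggr y = x}. pr y)
              = weight lam Tc p s eta x / (\<Sum>\<^sub>\<infinity>z\<in>reach_agg lam Tc p s eta. weight lam Tc p s eta z))"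
proof -
  let ?A = "reach_agg lam Tc p s eta" and ?w = "weight lam Tc p s eta"
  let ?Y = "\<lambda>x. {y\<in>S. aggr y = x}"
  obtain m where m0: "\<And>y. 0 \<le> m y" and mS: "\<And>y. y \<notin> S \<Longrightarrow> m y = 0"
    and mf: "\<And>z. (\<Sum>y | erase y = z. m y) = wt z"
    and mb: "\<And>y. y \<in> S \<Longrightarrow> m y * outr (erase y) = (\<Sum>x\<in>neighbours y. m x * Q x y)"
    using ex_balanced_lift by blast
  \<comment> \<open>The empty state has weight 1, so pi((0)) is \<open>1 / Z\<close>.\<close>
  define Z where "Z = (\<Sum>\<^sub>\<infinity>x\<in>?A. ?w x)"
  have "?A \<subseteq> {x. distinct (map fst x)}"
    using w0_distinct[OF w0_reachable] by (auto simp: reach_agg_def aggr_erase map_fst_aggz)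
  then have sA: "?w summable_on ?A" using summable summable_on_subset_banach by blast
  then have ZA: "(?w has_sum Z) ?A" unfolding Z_def by (rule has_sum_infsum)
  have YE: "erase y \<in> states_of x" if "y \<in> ?Y x" for x y
    using that w0_states_of[OF w0_reachable, of y] by (auto simp: aggr_erase)
  have fin_erase: "finite {y :: ('c \<times> 't option) list. erase y \<in> states_of x}" for x
  proof -
    have "{y. erase y \<in> states_of x} = (\<Union>z\<in>states_of x. {y :: ('c \<times> 't option) list. erase y = z})" by auto
    then show ?thesis by (simp add: finite_states_of finite_fibre)
  qed
  have fin: "finite (?Y x)" for x
    by (rule finite_subset[OF _ fin_erase[of x]]) (use YE in blast)
  have agg: "(\<Sum>y\<in>?Y x. m y) = ?w x" for x
  proof -
    have "(\<Sum>y\<in>?Y x. m y) = (\<Sum>y | erase y \<in> states_of x. m y)"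
    proof (rule sum.mono_neutral_left[OF fin_erase])
      show "?Y x \<subseteq> {y. erase y \<in> states_of x}" using YE by blast
      show "\<forall>y\<in>{y. erase y \<in> states_of x} - ?Y x. m y = 0"
        using mS by (auto simp: states_of_def aggr_erase)
    qed
    also have "\<dots> = (\<Sum>z\<in>states_of x. \<Sum>y | y \<in> {y. erase y \<in> states_of x} \<and> erase y = z. m y)"
      by (rule sum.group[symmetric, OF fin_erase finite_states_of]) auto
    also have "\<dots> = (\<Sum>z\<in>states_of x. wt z)"
    proof (intro sum.cong refl)
      fix z :: "('c + 't) list" assume "z \<in> states_of x"
      then have "{y. y \<in> {y. erase y \<in> states_of x} \<and> erase y = z} = {y. erase y = z}" by auto
      then show "(\<Sum>y | y \<in> {y. erase y \<in> states_of x} \<and> erase y = z. m y) = wt z"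
        using mf by simp
    qed
    finally show ?thesis by (simp add: sum_wt_states_of)
  qed
  \<comment> \<open>Split \<open>S\<close> into the finite fibres of \<open>aggr\<close>; as
    \<open>m\<close> is nonnegative, summability of the fibre sums gives summability over
    \<open>S\<close>.\<close>
  have sumS: "(m has_sum Z) S"
  proof -
    have inner: "((\<lambda>y. m (snd (x, y))) has_sum ?w x) (?Y x)" for x
      using agg[of x] fin by (simp add: has_sum_finiteI)
    have "((\<lambda>xy. m (snd xy)) has_sum Z) (Sigma ?A ?Y)"
      by (rule has_sum_SigmaI[OF inner ZA summable_on_SigmaI[OF inner sA]]) (simp add: m0)
    moreover have "bij_betw snd (Sigma ?A ?Y) S"
      by (rule bij_betwI[where g = "\<lambda>y. (aggr y, y)"]) (auto simp: reach_agg_def)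
    ultimately show ?thesis
      using has_sum_reindex_bij_betw[of snd "Sigma ?A ?Y" S m Z] by simp
  qed
  have nil: "[] \<in> S" by (simp add: reach_det_def)
  have "0 < Z"
  proof -
    have "[] \<in> ?A" using nil by (force simp: reach_agg_def aggr_def)
    moreover have "?w [] = 1" by (simp add: weight_def Pi_lam_def Pi_k_def)
    ultimately have "1 \<le> Z"
      using has_sum_mono_neutral[OF has_sum_finiteI[of "{[]}" 1 ?w] ZA] weight_nonneg by auto
    then show ?thesis by simp
  qed
  show ?thesis
  proof (intro exI[of _ "\<lambda>y. m y / Z"] conjI ballI)
    show "stationary lam Tc p s eta (\<lambda>y. m y / Z)"
      unfolding stationary_def
    proof (intro conjI ballI)
      show "((\<lambda>y. m y / Z) has_sum 1) S"
        using has_sum_cmult_left[OF sumS, of "1 / Z"] \<open>0 < Z\<close> by simp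
      show "0 \<le> m y / Z" for y using m0 \<open>0 < Z\<close> by simp
      fix y assume y: "y \<in> S"
      \<comment> \<open>The index sets can be exchanged because \<open>m\<close> vanishes off
        \<open>S\<close> and the rates into \<open>y\<close> vanish off its neighbours.\<close>
      have "(\<Sum>\<^sub>\<infinity>x\<in>S. m x / Z * Q x y) = (\<Sum>\<^sub>\<infinity>x\<in>neighbours y. m x / Z * Q x y)"
        by (rule infsum_cong_neutral) (use mS Q_neighbours in auto)
      also have "\<dots> = (\<Sum>x\<in>neighbours y. m x * Q x y) / Z"
        by (simp add: finite_neighbours sum_divide_distrib)
      finally show "m y / Z * out_rate lam Tc p s eta y = (\<Sum>\<^sub>\<infinity>x\<in>S. m x / Z * Q x y)"
        using mb[OF y] by (simp add: out_rate_erase)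
    qed
    show "(\<Sum>y\<in>?Y x. m y / Z) = ?w x / (\<Sum>\<^sub>\<infinity>z\<in>?A. ?w z)" for x
      using agg[of x] unfolding Z_def by (simp flip: sum_divide_distrib)
  qed
qed

end

theorem mainTheorem1:
  fixes lam :: "'c::finite \<Rightarrow> real" and Tc :: "'c \<Rightarrow> 't::finite set"
    and p :: "'t set \<Rightarrow> 'c \<Rightarrow> 't \<Rightarrow> real" and s :: "'t list \<Rightarrow> real" and eta :: "nat \<Rightarrow> real"
  assumes "\<forall>c. 0 < lam c"
    and "\<forall>c. Tc c \<noteq> {}"
    and "assignment_rule Tc p"
    and "assignment_condition lam p"
    and "order_independent s eta"
    and "weight lam Tc p s eta summable_on {x. distinct (map fst x)}"
  shows "\<exists>pr. stationary lam Tc p s eta pr \<and>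
           (\<forall>x\<in>reach_agg lam Tc p s eta.
              (\<Sum>y\<in>{y\<in>reach_det lam Tc p s eta. aggr y = x}. pr y)
              = weight lam Tc p s eta x / (\<Sum>\<^sub>\<infinity>z\<in>reach_agg lam Tc p s eta. weight lam Tc p s eta z))"
proof -
  interpret token_queue lam Tc p s eta
    by unfold_locales (use assms in auto)
  show ?thesis using assms(6) by (rule stationary_distribution)
qed

end
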